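(* Let $k \geq 2$ and define $\mathcal{U} \subset \mathit{GL}_2^+(\mathbb{R})^k$ as the largest open set such that every $\mathsf{A}=(A_1, \dots, A_k)\in \mathcal{U}$ satisfies the following conditions: (1) $\det A_1 < \det A_j$ for all $j = 2, 3, \dots, k$; (2) the matrix $A_1$ has distinct real eigenvalues; (3) $\mathsf{A}$ is not $1$-dominated. Then the set $$\mathcal{R}:=\left\{\mathsf{A} \in \mathcal{U} \colon \check{\varrho}(\mathsf{A})=\check{\varrho}\left(\wedge^2\mathsf{A}\right)^{1/2}\right\}$$ is a dense $G_\delta$ subset of $\mathcal{U}$, and every $\mathsf{A} \in \mathcal{R}$ fails to have the lower finiteness property.
   Context: $\mathit{GL}_2^+(\mathbb{R})$ is the set of real $2\times 2$ matrices with positive determinant. For a nonempty compact set $\mathsf{S}$ of linear endomorphisms of a finite-dimensional real vector space, the lower spectral radius is $$\check{\varrho}(\mathsf{S}) := \lim_{n\to\infty} \inf\{\|A_n\cdots A_1\|^{1/n} : A_1,\dots,A_n \in \mathsf{S}\} = \inf_{n\ge 1} \inf\{\|A_n\cdots A_1\|^{1/n} : A_1,\dots,A_n \in \mathsf{S}\},$$ independent of the operator norm. $\wedge^2 A$ is the second exterior power of $A$ and $\wedge^2\mathsf{A} := \{\wedge^2 A : A\in\mathsf{A}\}$. (For $2\times2$ matrices with positive determinant, $\check{\varrho}(\wedge^2\mathsf{A})^{1/2} = \inf_{A\in\mathsf{A}} (\det A)^{1/2}$.) Let $\sigma_1(A)\ge \sigma_2(A)$ denote the singular values of $A\in \mathit{GL}_2(\mathbb{R})$.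 A nonempty compact set $\mathsf{A}\subset \mathit{GL}_2(\mathbb{R})$ is $1$-dominated if there exist $C>1$, $\tau\in(0,1)$ such that $\sigma_2(A_n\cdots A_1)/\sigma_1(A_n\cdots A_1) \le C\tau^n$ for all $n\ge1$ and $A_1,\dots,A_n\in\mathsf{A}$. A finite set $\mathsf{A}$ of matrices has the lower finiteness property if there exist $n\ge1$ and $A_1,\dots,A_n\in\mathsf{A}$ such that $\rho(A_n\cdots A_1)^{1/n}=\check{\varrho}(\mathsf{A})$, where $\rho$ denotes the ordinary spectral radius. All of these notions are applied to a $k$-tuple $(A_1,\dots,A_k)$ by applying them to the associated set $\{A_1,\dots,A_k\}$. *)

theory Defs
  imports "HOL-Analysis.Analysis"
begin

definition GL2_pos :: "(real^2^2) set" where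
  "GL2_pos = {A. det A > 0}"

definition eigenvalue :: "'a::field^'n^'n \<Rightarrow> 'a \<Rightarrow> bool" where
  "eigenvalue A c \<longleftrightarrow> (\<exists>v. v \<noteq> 0 \<and> A *v v = c *s v)"

definition complexify :: "real^'n^'m \<Rightarrow> complex^'n^'m" where
  "complexify A = (\<chi> i j. complex_of_real (A $ i $ j))"

definition spectral_radius :: "real^'n^'n \<Rightarrow> real" where
  "spectral_radius A = Max (cmod ` {c. eigenvalue (complexify A) c})"

text \<open>A \<open>2 \<times> 2\<close> matrix has exactly two singular values counted with multiplicity,
  so they are the maximum and the minimum (equal if the multiplicity is two) of this set.\<close>

definition singular_values :: "real^2^2 \<Rightarrow> real set" where
  "singular_values A = {s. s \<ge> 0 \<and> eigenvalue (transpose A ** A) (s\<^sup>2)}"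

definition sigma1 :: "real^2^2 \<Rightarrow> real" where
  "sigma1 A = Max (singular_values A)"

definition sigma2 :: "real^2^2 \<Rightarrow> real" where
  "sigma2 A = Min (singular_values A)"

text \<open>Words \<open>A\<^sub>n \<cdots> A\<^sub>1\<close> are represented by lists \<open>[A\<^sub>n, \<dots>, A\<^sub>1]\<close>.\<close>

definition matrix_prod :: "(real^'n^'n) list \<Rightarrow> real^'n^'n" where
  "matrix_prod As = foldr (**) As (mat 1)"

definition compose_list :: "('a \<Rightarrow> 'a) list \<Rightarrow> 'a \<Rightarrow> 'a" where
  "compose_list fs = foldr (\<circ>) fs id"

text \<open>The junk value of the sequence at \<open>n = 0\<close> does not affect the limit.\<close>

definition lower_spectral_radius :: "('a::euclidean_space \<Rightarrow> 'a) set \<Rightarrow> real" where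
  "lower_spectral_radius S =
     lim (\<lambda>n. Inf {root n (onorm (compose_list fs)) | fs. length fs = n \<and> set fs \<subseteq> S})"

abbreviation lower_spectral_radius_mat :: "(real^'n^'n) set \<Rightarrow> real" where
  "lower_spectral_radius_mat \<A> \<equiv> lower_spectral_radius ((*v) ` \<A>)"

text \<open>The exterior square of \<open>\<real>\<^sup>2\<close> is modelled by the line \<open>\<real>\<close>, with basis vector
  \<open>e\<^sub>1 \<and> e\<^sub>2 = 1\<close>; \<open>wedge_universal\<close> below is its universal property.  The map
  \<open>ext_square A\<close> is characterised by \<open>u \<and> v \<mapsto> Au \<and> Av\<close>.\<close>

definition wedge :: "real^2 \<Rightarrow> real^2 \<Rightarrow> real" where
  "wedge u v = u $ 1 * v $ 2 - u $ 2 * v $ 1"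

definition ext_square :: "real^2^2 \<Rightarrow> real \<Rightarrow> real" where
  "ext_square A = (THE L. linear L \<and> (\<forall>u v. L (wedge u v) = wedge (A *v u) (A *v v)))"

lemma wedge_universal:
  fixes f :: "real^2 \<Rightarrow> real^2 \<Rightarrow> 'b::real_vector"
  assumes l: "\<And>v. linear (\<lambda>u. f u v)" and r: "\<And>u. linear (f u)" and alt: "\<And>u. f u u = 0"
  shows "\<exists>!L. linear L \<and> (\<forall>u v. L (wedge u v) = f u v)"
proof -
  let ?e = "axis 1 1 :: real^2" and ?g = "axis 2 1 :: real^2"
  have dec: "u = u $ 1 *\<^sub>R ?e + u $ 2 *\<^sub>R ?g" for u :: "real^2"
    by (simp add: vec_eq_iff forall_2 axis_def)
  have ladd: "f (a + b) v = f a v + f b v" "f (c *\<^sub>R a) v = c *\<^sub>R f a v" for a b c v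
    using linear_add[OF l] linear_scale[OF l] by auto
  have radd: "f u (a + b) = f u a + f u b" "f u (c *\<^sub>R a) = c *\<^sub>R f u a" for a b c u
    using linear_add[OF r] linear_scale[OF r] by auto
  have anti: "f ?g ?e = - f ?e ?g"
  proof -
    have "0 = f (?e + ?g) (?e + ?g)"
      by (rule alt[symmetric])
    also have "\<dots> = f ?g ?e + f ?e ?g"
      unfolding ladd radd alt[of "?e"] alt[of "?g"] by simp
    finally show ?thesis
      unfolding eq_neg_iff_add_eq_0 by (rule sym)
  qed
  have main: "f u v = wedge u v *\<^sub>R f ?e ?g" for u v
  proof -
    have "f u v = f (u $ 1 *\<^sub>R ?e + u $ 2 *\<^sub>R ?g) (v $ 1 *\<^sub>R ?e + v $ 2 *\<^sub>R ?g)"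
      by (rule arg_cong2[of _ _ _ _ f, OF dec dec])
    also have "\<dots> = wedge u v *\<^sub>R f ?e ?g"
      unfolding ladd radd alt[of "?e"] alt[of "?g"] anti wedge_def by (simp add: scaleR_diff_left mult.commute)
    finally show ?thesis .
  qed
  have w: "wedge (t *\<^sub>R ?e) ?g = t" for t
    by (simp add: wedge_def axis_def)
  show ?thesis
  proof (rule ex1I[of _ "\<lambda>t. t *\<^sub>R f ?e ?g"])
    show "linear (\<lambda>t. t *\<^sub>R f ?e ?g) \<and> (\<forall>u v. wedge u v *\<^sub>R f ?e ?g = f u v)"
      by (intro conjI allI linearI main[symmetric]) (auto simp: scaleR_add_left)
  next
    fix L assume L: "linear L \<and> (\<forall>u v. L (wedge u v) = f u v)"
    show "L = (\<lambda>t. t *\<^sub>R f ?e ?g)"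
    proof
      fix t
      have "L t = f (t *\<^sub>R ?e) ?g" using L w[of t] by metis
      then show "L t = t *\<^sub>R f ?e ?g" by (simp only: ladd)
    qed
  qed
qed

lemma ext_square_wedge:
  "linear (ext_square A)" "ext_square A (wedge u v) = wedge (A *v u) (A *v v)"
proof -
  have "\<exists>!L. linear L \<and> (\<forall>u v. L (wedge u v) = wedge (A *v u) (A *v v))"
    by (rule wedge_universal)
      (auto intro!: linearI simp: wedge_def matrix_vector_right_distrib
         matrix_vector_mult_scaleR algebra_simps)
  then have "linear (ext_square A) \<and> (\<forall>u v. ext_square A (wedge u v) = wedge (A *v u) (A *v v))"
    unfolding ext_square_def by (rule theI')
  then show "linear (ext_square A)" "ext_square A (wedge u v) = wedge (A *v u) (A *v v)"
    by auto
qed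

lemma ext_square_eq_det: "ext_square A t = det A * t"
proof -
  have "wedge (axis 1 t) (axis 2 1) = t"
    by (simp add: wedge_def axis_def)
  then have "ext_square A t = wedge (A *v axis 1 t) (A *v axis 2 1)"
    using ext_square_wedge(2)[of A "axis 1 t" "axis 2 1"] by simp
  also have "\<dots> = det A * t"
    by (simp add: wedge_def det_2 matrix_vector_mult_def sum_2 axis_def algebra_simps)
  finally show ?thesis .
qed

definition one_dominated :: "(real^2^2) set \<Rightarrow> bool" where
  "one_dominated \<A> \<longleftrightarrow>
     (\<exists>C>1. \<exists>\<tau>\<in>{0<..<1}. \<forall>n\<ge>1. \<forall>As. length As = n \<and> set As \<subseteq> \<A> \<longrightarrow>
        sigma2 (matrix_prod As) / sigma1 (matrix_prod As) \<le> C * \<tau> ^ n)"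

definition lower_finiteness_property :: "(real^'n^'n) set \<Rightarrow> bool" where
  "lower_finiteness_property \<A> \<longleftrightarrow>
     (\<exists>n\<ge>1. \<exists>As. length As = n \<and> set As \<subseteq> \<A> \<and>
        root n (spectral_radius (matrix_prod As)) = lower_spectral_radius_mat \<A>)"

text \<open>A \<open>k\<close>-tuple is an extensional function on \<open>{1..k}\<close>; the set associated with it
  is \<open>A ` {1..k}\<close>.\<close>

definition GL2_pos_tuples :: "nat \<Rightarrow> (nat \<Rightarrow> real^2^2) topology" where
  "GL2_pos_tuples k = product_topology (\<lambda>_. top_of_set GL2_pos) {1..k}"

definition U_set :: "nat \<Rightarrow> (nat \<Rightarrow> real^2^2) set" where
  "U_set k = (GL2_pos_tuples k) interior_of
     {A \<in> topspace (GL2_pos_tuples k).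
        (\<forall>j\<in>{2..k}. det (A 1) < det (A j)) \<and>
        (\<exists>a b. a \<noteq> b \<and> eigenvalue (A 1) a \<and> eigenvalue (A 1) b) \<and>
        \<not> one_dominated (A ` {1..k})}"

definition R_set :: "nat \<Rightarrow> (nat \<Rightarrow> real^2^2) set" where
  "R_set k = {A \<in> U_set k.
     lower_spectral_radius_mat (A ` {1..k}) =
       sqrt (lower_spectral_radius (ext_square ` (A ` {1..k})))}"

end

theory Submission
  imports Defs
begin

text \<open>
  Write \<open>L\<close> for the square root of \<open>det A\<^sub>1\<close>.  A product of \<open>n\<close> letters has determinant at least
  \<open>L\<^sup>2\<^sup>n\<close>, and the square of an operator norm dominates the determinant, so the lower spectral radius
  of a tuple in \<open>\<U>\<close> is at least \<open>L\<close>; on the exterior square it equals \<open>L\<^sup>2\<close>.  Hence \<open>\<R>\<close> consists of the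
  tuples in \<open>\<U>\<close> whose lower spectral radius attains its smallest conceivable value \<open>L\<close>
  (\<open>R_set_iff\<close>).  The three claims follow from this description.

  \<^emph>\<open>The set is a G-delta.\<close>  By Fekete's argument the limit defining the lower spectral radius is an
  infimum over words, each of which contributes a continuous function of the tuple.  So
  \<open>lower spectral radius < L + \<epsilon>\<close> is an open condition.

  \<^emph>\<open>No lower finiteness.\<close>  The square of a spectral radius dominates the determinant too.  If a word
  of length \<open>n\<close> had spectral radius \<open>L\<^sup>n\<close>, its determinant would be at most \<open>L\<^sup>2\<^sup>n\<close>, which forces every
  letter to be \<open>A\<^sub>1\<close>.  But \<open>A\<^sub>1\<close> has distinct real eigenvalues with product \<open>L\<^sup>2\<close>, so the spectral radius
  of its powers is strictly larger (\<open>not_lower_finiteness\<close>).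

  \<^emph>\<open>Density.\<close>  Let \<open>u\<close> and \<open>s\<close> be the expanding and the contracting eigenvector of \<open>A\<^sub>1\<close>.  Suppose that
  some word \<open>Q\<close> is a connection, that is, \<open>Q u\<close> is parallel to \<open>s\<close>.  In \<open>A\<^sub>1\<^sup>n Q A\<^sub>1\<^sup>n\<close> the growth along \<open>u\<close>
  in the right factor is cancelled by the decay along \<open>s\<close> in the left one, so these words have norm
  at most a constant times \<open>L\<^sup>2\<^sup>n\<close>, and the tuple belongs to \<open>\<R>\<close>
  (\<open>lower_spectral_radius_le_of_connection\<close>).  It remains to create a connection by an arbitrarily
  small perturbation.

  Left multiplication of all letters by the shear that fixes \<open>s\<close> and adds \<open>t s\<close> to \<open>u\<close> keeps \<open>s\<close> an
  eigenvector of the first letter and moves \<open>u\<close> to an explicit vector \<open>u\<^sub>t\<close>.  Measure directions by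
  their slope \<open>z\<close>, where \<open>u + z s\<close> has slope \<open>z\<close> and \<open>s\<close> has slope infinity.  Then the letters act by
  increasing Moebius maps followed by the translation by \<open>t\<close>, and a connection is a word which sends
  the slope of \<open>u\<^sub>t\<close> to infinity.  If this never happens for \<open>\<bar>t\<bar> \<le> 2\<delta>\<close>, then the slopes reached are
  finite, increase with \<open>t\<close> at unit speed or faster, and therefore keep the distance \<open>\<delta>\<close> from every
  pole as long as \<open>\<bar>t\<bar> \<le> \<delta>\<close>; so they stay in a bounded set.  The unperturbed letters map the interval
  between the slopes at \<open>-\<delta>\<close> and \<open>\<delta>\<close> of a word into the corresponding interval of the longer word,
  with room \<open>\<delta>\<close> to spare on both sides.  Such a map contracts the Hilbert metric by a uniform factor,
  and this makes the tuple 1-dominated (\<open>no_connection_imp_one_dominated\<close>), which is impossible in \<open>\<U>\<close>.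
  The argument needs every letter but the first to move \<open>s\<close>; a preliminary generic perturbation
  ensures it (\<open>separate_from_eigendirection\<close>).
\<close>

section \<open>The lower spectral radius of a finite set\<close>

lemma compose_list_Nil [simp]: "compose_list [] = id"
  and compose_list_Cons [simp]: "compose_list (f # fs) = f \<circ> compose_list fs"
  by (simp_all add: compose_list_def)

lemma compose_list_append [simp]: "compose_list (fs @ gs) = compose_list fs \<circ> compose_list gs"
  by (induction fs) (simp_all add: comp_assoc)

lemma linear_compose_list:
  "(\<And>f. f \<in> set fs \<Longrightarrow> linear f) \<Longrightarrow> linear (compose_list fs)"
  by (induction fs) (auto intro: linear_compose linear_id)

lemma onorm_append_le:
  fixes fs gs :: "('a::euclidean_space \<Rightarrow> 'a) list"
  assumes "\<And>f. f \<in> set fs \<union> set gs \<Longrightarrow> linear f"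
  shows "onorm (compose_list (fs @ gs)) \<le> onorm (compose_list fs) * onorm (compose_list gs)"
  unfolding compose_list_append
  using assms by (intro onorm_compose linear_conv_bounded_linear[THEN iffD1] linear_compose_list) auto

lemma onorm_compose_list_nonneg:
  fixes fs :: "('a::euclidean_space \<Rightarrow> 'a) list"
  shows "(\<And>f. f \<in> set fs \<Longrightarrow> linear f) \<Longrightarrow> 0 \<le> onorm (compose_list fs)"
  by (intro onorm_pos_le linear_conv_bounded_linear[THEN iffD1] linear_compose_list) auto

lemma onorm_replicate_le:
  fixes fs :: "('a::euclidean_space \<Rightarrow> 'a) list"
  assumes "\<And>f. f \<in> set fs \<Longrightarrow> linear f"
  shows "onorm (compose_list (concat (replicate q fs))) \<le> onorm (compose_list fs) ^ q"
proof (induction q)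
  case 0
  show ?case by (simp add: id_def onorm_id)
next
  case (Suc q)
  have "onorm (compose_list (concat (replicate (Suc q) fs))) \<le>
      onorm (compose_list fs) * onorm (compose_list (concat (replicate q fs)))"
    using onorm_append_le[of fs "concat (replicate q fs)"] assms by auto
  also have "\<dots> \<le> onorm (compose_list fs) * onorm (compose_list fs) ^ q"
    using Suc onorm_compose_list_nonneg[OF assms] by (intro mult_left_mono) auto
  finally show ?case by (simp add: comp_def)
qed

text \<open>The upper half of Fekete's lemma.  A word that is good at one length is repeated as often as
  possible and then filled up with fewer than \<open>length fs\<close> copies of its first letter; the filling costs a
  factor \<open>K\<close> that does not depend on the length \<open>N\<close>.\<close>
lemma onorm_long_words:
  fixes S :: "('a::euclidean_space \<Rightarrow> 'a) set"
  assumes lin: "\<And>f. f \<in> S \<Longrightarrow> linear f"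
    and fs: "fs \<noteq> []" "set fs \<subseteq> S" and \<rho>: "0 < \<rho>" "onorm (compose_list fs) \<le> \<rho> ^ length fs"
  obtains K where "0 < K"
    "\<And>N. \<exists>gs. length gs = N \<and> set gs \<subseteq> S \<and> onorm (compose_list gs) \<le> K * \<rho> ^ N"
proof -
  define f where "f = hd fs"
  define n where "n = length fs"
  have n: "n > 0" and f: "f \<in> S" using fs by (auto simp: n_def f_def)
  \<comment> \<open>each filling letter costs at most \<open>m\<close> times its budget \<open>\<rho>\<close>\<close>
  define m where "m = max 1 (onorm f / \<rho>)"
  have f0: "0 \<le> onorm f" using lin f by (intro onorm_pos_le linear_conv_bounded_linear[THEN iffD1]) auto
  show ?thesis
  proof (rule that[of "m ^ n"])
    show "0 < m ^ n" by (simp add: m_def)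
    fix N
    define q where "q = N div n"
    define r where "r = N mod n"
    have N: "N = q * n + r" by (simp add: q_def r_def)
    define gs where "gs = concat (replicate q fs) @ concat (replicate r [f])"
    have len: "length gs = N"
      by (simp add: gs_def N length_concat sum_list_replicate n_def)
    have "onorm (compose_list gs) \<le>
        onorm (compose_list (concat (replicate q fs))) * onorm (compose_list (concat (replicate r [f])))"
      unfolding gs_def using fs f lin by (intro onorm_append_le) auto
    also have "\<dots> \<le> onorm (compose_list fs) ^ q * onorm (compose_list [f]) ^ r"
      using fs f lin
      by (intro mult_mono onorm_replicate_le onorm_compose_list_nonneg zero_le_power) auto
    also have "\<dots> \<le> (\<rho> ^ n) ^ q * (m ^ n * \<rho> ^ r)"
    proof (intro mult_mono)
      show "onorm (compose_list fs) ^ q \<le> (\<rho> ^ n) ^ q"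
        using \<rho> fs lin by (intro power_mono onorm_compose_list_nonneg) (auto simp: n_def)
      have "onorm f \<le> m * \<rho>" using \<rho> by (simp add: m_def pos_divide_le_eq[symmetric])
      then have "onorm f ^ r \<le> (m * \<rho>) ^ r" using f0 by (intro power_mono)
      also have "\<dots> = m ^ r * \<rho> ^ r" by (simp add: power_mult_distrib)
      also have "\<dots> \<le> m ^ n * \<rho> ^ r"
        using n \<rho> by (intro mult_right_mono power_increasing) (auto simp: r_def m_def less_imp_le)
      finally show "onorm (compose_list [f]) ^ r \<le> m ^ n * \<rho> ^ r" by simp
    qed (use f0 \<rho> in auto)
    also have "\<dots> = m ^ n * \<rho> ^ N"
      by (simp add: N power_add power_mult[symmetric] mult.commute)
    finally show "\<exists>gs. length gs = N \<and> set gs \<subseteq> S \<and> onorm (compose_list gs) \<le> m ^ n * \<rho> ^ N"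
      using len fs f by (intro exI[of _ gs]) (auto simp: gs_def)
  qed
qed

text \<open>The only facts about the defining limit that are used later: it exists, and it is the infimum over
  all nonempty words.  Finiteness of \<open>S\<close> makes the infimum at each length a minimum.\<close>
lemma
  fixes S :: "('a::euclidean_space \<Rightarrow> 'a) set"
  assumes fin: "finite S" and ne: "S \<noteq> {}" and lin: "\<And>f. f \<in> S \<Longrightarrow> linear f"
  shows lower_spectral_radius_le:
      "\<lbrakk>fs \<noteq> []; set fs \<subseteq> S\<rbrakk> \<Longrightarrow> lower_spectral_radius S ^ length fs \<le> onorm (compose_list fs)"
    and lower_spectral_radius_approx:
      "0 < e \<Longrightarrow> \<exists>fs. fs \<noteq> [] \<and> set fs \<subseteq> S \<and> onorm (compose_list fs) < (lower_spectral_radius S + e) ^ length fs"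
    and lower_spectral_radius_nonneg: "0 \<le> lower_spectral_radius S"
proof -
  define W where "W n = {root n (onorm (compose_list fs)) | fs. length fs = n \<and> set fs \<subseteq> S}" for n
  define v where "v n = Inf (W n)" for n
  define L where "L = Inf (v ` {1..})"
  have W_img: "W n = (\<lambda>fs. root n (onorm (compose_list fs))) ` {fs. set fs \<subseteq> S \<and> length fs = n}" for n
    by (auto simp: W_def)
  have finW: "finite (W n)" for n
    unfolding W_img using finite_lists_length_eq[OF fin] by simp
  have neW: "W n \<noteq> {}" for n
  proof -
    obtain f where "f \<in> S" using ne by auto
    then have "replicate n f \<in> {fs. set fs \<subseteq> S \<and> length fs = n}" by auto
    then show ?thesis unfolding W_img by blast
  qed
  have onn: "0 \<le> onorm (compose_list fs)" if "set fs \<subseteq> S" for fs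
    using that lin by (intro onorm_compose_list_nonneg) auto
  have v_le: "v n \<le> root n (onorm (compose_list fs))" if "length fs = n" "set fs \<subseteq> S" for n fs
    unfolding v_def using finW that by (intro cInf_lower) (auto simp: W_def intro: bdd_below_finite)
  have v_mem: "v n \<in> W n" for n
    unfolding v_def using Min_in[OF finW neW] cInf_eq_Min[OF finW neW] by metis
  have v0: "0 \<le> v n" if "1 \<le> n" for n
    using v_mem[of n] real_root_ge_zero[OF onn] by (auto simp: W_def)
  have bdd: "bdd_below (v ` {1..})" using v0 by (intro bdd_belowI[of _ 0]) auto
  have L_le: "L \<le> v n" if "1 \<le> n" for n
    unfolding L_def using bdd that by (intro cInf_lower) auto
  have L0: "0 \<le> L" unfolding L_def using v0 by (intro cInf_greatest) auto
  have approx: "\<exists>fs. fs \<noteq> [] \<and> set fs \<subseteq> S \<and> onorm (compose_list fs) < (L + e) ^ length fs" if "0 < e" for e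
  proof -
    have "v ` {1..} \<noteq> {}" "Inf (v ` {1..}) < L + e"
      using that unfolding L_def by auto
    then obtain x where "x \<in> v ` {1..}" "x < L + e" using cInf_lessD by metis
    then obtain n where n: "1 \<le> n" "v n < L + e" by blast
    obtain fs where fs: "v n = root n (onorm (compose_list fs))" "length fs = n" "set fs \<subseteq> S"
      using v_mem[of n] unfolding W_def by blast
    have "onorm (compose_list fs) = v n ^ n"
      using fs n onn by simp
    also have "\<dots> < (L + e) ^ n" using n v0 by (intro power_strict_mono) auto
    finally have "onorm (compose_list fs) < (L + e) ^ length fs" using fs by simp
    moreover have "fs \<noteq> []" using fs n by auto
    ultimately show ?thesis using fs by blast
  qed
  \<comment> \<open>one good word gives good words of every length, up to a constant whose roots tend to 1\<close>
  have "v \<longlonglongrightarrow> L"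
  proof (rule LIMSEQ_I)
    fix e :: real assume e: "0 < e"
    define \<rho> where "\<rho> = L + e / 2"
    have \<rho>: "0 < \<rho>" using e L0 by (simp add: \<rho>_def)
    obtain fs where fs: "fs \<noteq> []" "set fs \<subseteq> S" "onorm (compose_list fs) < \<rho> ^ length fs"
      using approx[of "e / 2"] e unfolding \<rho>_def by auto
    obtain K where K: "0 < K"
      "\<And>N. \<exists>gs. length gs = N \<and> set gs \<subseteq> S \<and> onorm (compose_list gs) \<le> K * \<rho> ^ N"
      using onorm_long_words[OF lin fs(1,2) \<rho> less_imp_le[OF fs(3)]] by blast
    have "(\<lambda>N. root N K * \<rho>) \<longlonglongrightarrow> 1 * \<rho>"
      using K by (intro tendsto_mult LIMSEQ_root_const tendsto_const)
    then have "\<forall>\<^sub>F N in sequentially. root N K * \<rho> < L + e"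
      using e by (intro order_tendstoD(2)) (auto simp: \<rho>_def)
    then have "\<forall>\<^sub>F N in sequentially. norm (v N - L) < e"
      using eventually_ge_at_top[of 1]
    proof eventually_elim
      case (elim N)
      obtain gs where gs: "length gs = N" "set gs \<subseteq> S" "onorm (compose_list gs) \<le> K * \<rho> ^ N"
        using K by blast
      have "v N \<le> root N (onorm (compose_list gs))" using v_le gs by blast
      also have "\<dots> \<le> root N (K * \<rho> ^ N)" using gs elim by simp
      also have "\<dots> = root N K * \<rho>" using elim \<rho> by (simp add: real_root_mult real_root_power_cancel)
      finally show ?case using elim L_le[of N] by auto
    qed
    then show "\<exists>N0. \<forall>N\<ge>N0. norm (v N - L) < e" by (simp add: eventually_sequentially)
  qed
  then have lsr: "lower_spectral_radius S = L"
    unfolding lower_spectral_radius_def v_def W_def by (rule limI)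
  show "0 \<le> lower_spectral_radius S" using L0 lsr by simp
  show "\<exists>fs. fs \<noteq> [] \<and> set fs \<subseteq> S \<and> onorm (compose_list fs) < (lower_spectral_radius S + e) ^ length fs"
    if "0 < e" using approx that lsr by simp
  show "lower_spectral_radius S ^ length fs \<le> onorm (compose_list fs)" if "fs \<noteq> []" "set fs \<subseteq> S"
  proof -
    have l: "1 \<le> length fs" using that by (cases fs) auto
    have "L ^ length fs \<le> root (length fs) (onorm (compose_list fs)) ^ length fs"
      using L0 l L_le[of "length fs"] v_le[of fs "length fs"] that by (intro power_mono) auto
    also have "\<dots> = onorm (compose_list fs)" using l onn that by simp
    finally show ?thesis using lsr by simp
  qed
qed

lemma lower_spectral_radius_greatest:
  fixes S :: "('a::euclidean_space \<Rightarrow> 'a) set"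
  assumes S: "finite S" "S \<noteq> {}" "\<And>f. f \<in> S \<Longrightarrow> linear f"
    and L: "\<And>fs. \<lbrakk>fs \<noteq> []; set fs \<subseteq> S\<rbrakk> \<Longrightarrow> L ^ length fs \<le> onorm (compose_list fs)"
  shows "L \<le> lower_spectral_radius S"
proof (rule field_le_epsilon)
  fix e :: real assume e: "0 < e"
  obtain fs where fs: "fs \<noteq> []" "set fs \<subseteq> S" "onorm (compose_list fs) < (lower_spectral_radius S + e) ^ length fs"
    using lower_spectral_radius_approx[OF S e] by auto
  have "L ^ length fs < (lower_spectral_radius S + e) ^ length fs"
    using fs L by fastforce
  then have "L < lower_spectral_radius S + e"
    using lower_spectral_radius_nonneg[OF S] e by (auto dest: power_less_imp_less_base)
  then show "L \<le> lower_spectral_radius S + e" by simp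
qed

section \<open>Matrix products, eigenvalues and operator norms\<close>

lemma matrix_prod_Nil [simp]: "matrix_prod [] = mat 1"
  and matrix_prod_Cons [simp]: "matrix_prod (A # As) = A ** matrix_prod As"
  by (simp_all add: matrix_prod_def)

lemma matrix_prod_append: "matrix_prod (As @ Bs) = matrix_prod As ** matrix_prod Bs"
  by (induction As) (simp_all add: matrix_mul_assoc)

lemma compose_list_matrices: "compose_list (map (*v) As) = (*v) (matrix_prod As)"
  by (induction As) (simp_all add: fun_eq_iff matrix_vector_mul_assoc)

lemma det_matrix_prod: "det (matrix_prod As) = (\<Prod>A\<leftarrow>As. det A)"
  by (induction As) (simp_all add: det_mul)

lemma eigenvalue_iff_det:
  fixes A :: "'a::field^'n^'n"
  shows "eigenvalue A c \<longleftrightarrow> det (A - mat c) = 0"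
proof -
  have "(mat c *v v) $ i = c * v $ i" for v :: "'a^'n" and i
  proof -
    have "(mat c *v v) $ i = (\<Sum>j\<in>UNIV. (if i = j then c else 0) * v $ j)"
      by (simp add: matrix_vector_mult_def mat_def)
    also have "\<dots> = (\<Sum>j\<in>UNIV. if i = j then c * v $ j else 0)"
      by (rule sum.cong) auto
    finally show ?thesis by simp
  qed
  then have "mat c *v v = c *s v" for v :: "'a^'n" by (simp add: vec_eq_iff)
  then have "(A - mat c) *v v = A *v v - c *s v" for v
    by (simp add: matrix_vector_mult_diff_rdistrib)
  then have "eigenvalue A c \<longleftrightarrow> \<not> invertible (A - mat c)"
    unfolding eigenvalue_def invertible_left_inverse matrix_left_invertible_ker by auto
  then show ?thesis by (simp add: invertible_det_nz)
qed

text \<open>Lagrange's identity: the squares of the wedge and of the inner product add up to the product of the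
  squared norms.\<close>
lemma abs_wedge_le: "\<bar>wedge u v\<bar> \<le> norm u * norm v"
proof -
  have "(wedge u v)\<^sup>2 + (u \<bullet> v)\<^sup>2 = (u \<bullet> u) * (v \<bullet> v)"
    by (simp add: wedge_def inner_vec_def sum_2 power2_eq_square algebra_simps)
  then have "(wedge u v)\<^sup>2 \<le> (norm u * norm v)\<^sup>2"
    by (simp add: power_mult_distrib power2_norm_eq_inner) (metis le_add_same_cancel1 zero_le_power2)
  then show ?thesis by (metis abs_le_square_iff abs_of_nonneg mult_nonneg_nonneg norm_ge_zero)
qed

lemma wedge_matrix: "wedge (A *v u) (A *v v) = det A * wedge u v"
  using ext_square_wedge(2)[of A u v] by (simp add: ext_square_eq_det)

text \<open>The determinant is the wedge of the images of the two unit vectors.\<close>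
lemma abs_det_le_onorm_sq: "\<bar>det (A :: real^2^2)\<bar> \<le> (onorm ((*v) A))\<^sup>2"
proof -
  let ?e = "axis 1 1 :: real^2" and ?g = "axis 2 1 :: real^2"
  have "det A = wedge (A *v ?e) (A *v ?g)" by (simp add: wedge_matrix) (simp add: wedge_def axis_def)
  then have "\<bar>det A\<bar> \<le> norm (A *v ?e) * norm (A *v ?g)" using abs_wedge_le by metis
  also have "\<dots> \<le> onorm ((*v) A) * onorm ((*v) A)"
    using onorm[of "(*v) A" ?e] onorm[of "(*v) A" ?g]
    by (intro mult_mono onorm_pos_le) auto
  finally show ?thesis by (simp add: power2_eq_square)
qed

lemma onorm_matrix_diff_le:
  fixes A B :: "real^'n^'m"
  shows "onorm ((*v) A) - onorm ((*v) B) \<le> real CARD('m) * real CARD('n) * norm (A - B)"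
proof -
  have "onorm ((*v) A) = onorm (\<lambda>x. (A - B) *v x + B *v x)"
    by (simp add: matrix_vector_mult_add_rdistrib[symmetric])
  also have "\<dots> \<le> onorm ((*v) (A - B)) + onorm ((*v) B)"
    by (rule onorm_triangle) auto
  also have "onorm ((*v) (A - B)) \<le> real CARD('m) * real CARD('n) * norm (A - B)"
    by (intro onorm_le_matrix_component)
      (metis Finite_Cartesian_Product.norm_nth_le order_trans real_norm_def)
  finally show ?thesis by simp
qed

text \<open>The operator norm is Lipschitz in the entries.\<close>
lemma continuous_on_onorm_matrix: "continuous_on UNIV (\<lambda>A :: real^'n^'m. onorm ((*v) A))"
proof -
  define K where "K = real CARD('m) * real CARD('n)"
  have "dist (onorm ((*v) A)) (onorm ((*v) B)) \<le> K * dist A B" for A B :: "real^'n^'m"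
    using onorm_matrix_diff_le[of A B] onorm_matrix_diff_le[of B A]
    by (simp add: dist_norm norm_minus_commute K_def abs_le_iff)
  then have "K-lipschitz_on UNIV (\<lambda>A :: real^'n^'m. onorm ((*v) A))"
    by (intro lipschitz_onI) (auto simp: K_def)
  then show ?thesis by (rule lipschitz_on_continuous_on)
qed

lemma continuous_on_matrix_mult [continuous_intros]:
  fixes f :: "'a::topological_space \<Rightarrow> real^'n^'m" and g :: "'a \<Rightarrow> real^'k^'n"
  assumes "continuous_on S f" "continuous_on S g"
  shows "continuous_on S (\<lambda>x. f x ** g x)"
  unfolding matrix_matrix_mult_def
  by (intro continuous_on_vec_lambda continuous_intros assms)

section \<open>Spectral radius of a two by two matrix\<close>

text \<open>Keeps the discriminant out of the sequel: only the product of the two roots matters.\<close>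
lemma quadratic_factorization:
  fixes T D :: complex
  obtains r s where "r * s = D" "\<And>c. c\<^sup>2 - T * c + D = (c - r) * (c - s)"
proof -
  define w where "w = csqrt (T\<^sup>2 / 4 - D)"
  have w: "w\<^sup>2 = T\<^sup>2 / 4 - D" by (simp add: w_def)
  have 1: "(T / 2 + w) * (T / 2 - w) = D"
    using w by (simp add: power2_eq_square algebra_simps)
  have "(c - (T / 2 + w)) * (c - (T / 2 - w)) = c\<^sup>2 - T * c + (T / 2 + w) * (T / 2 - w)" for c
    by (simp add: power2_eq_square algebra_simps)
  with 1 show ?thesis by (intro that[of "T / 2 + w" "T / 2 - w"]) auto
qed

lemma complexify_eigenvalues:
  fixes A :: "real^2^2"
  obtains r s where "{c. eigenvalue (complexify A) c} = {r, s}" "cmod r * cmod s = \<bar>det A\<bar>"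
proof -
  obtain r s where rs: "r * s = complex_of_real (det A)"
    "\<And>c. c\<^sup>2 - complex_of_real (A $ 1 $ 1 + A $ 2 $ 2) * c + complex_of_real (det A) = (c - r) * (c - s)"
    using quadratic_factorization by blast
  have "det (complexify A - mat c) = (c - r) * (c - s)" for c
    unfolding rs(2)[symmetric]
    by (simp add: det_2 complexify_def mat_def power2_eq_square algebra_simps)
  then have "{c. eigenvalue (complexify A) c} = {r, s}"
    by (auto simp: eigenvalue_iff_det)
  moreover have "cmod r * cmod s = \<bar>det A\<bar>"
    using rs(1) by (metis norm_mult norm_of_real)
  ultimately show ?thesis by (rule that)
qed

text \<open>The moduli of the two complex eigenvalues multiply to the modulus of the determinant, so the
  larger one is at least its square root.\<close>
lemma spectral_radius_sq_ge_det:
  fixes A :: "real^2^2"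
  shows "\<bar>det A\<bar> \<le> (spectral_radius A)\<^sup>2"
proof -
  obtain r s where rs: "{c. eigenvalue (complexify A) c} = {r, s}" "cmod r * cmod s = \<bar>det A\<bar>"
    using complexify_eigenvalues .
  have "spectral_radius A = max (cmod r) (cmod s)" by (simp add: spectral_radius_def rs)
  then show ?thesis
    unfolding rs(2)[symmetric] power2_eq_square by (auto intro!: mult_mono simp: max_def)
qed

lemma eigenvalue_le_spectral_radius:
  fixes A :: "real^2^2"
  assumes "eigenvalue A c"
  shows "\<bar>c\<bar> \<le> spectral_radius A"
proof -
  obtain r s where rs: "{c. eigenvalue (complexify A) c} = {r, s}" "cmod r * cmod s = \<bar>det A\<bar>"
    using complexify_eigenvalues .
  have "det (complexify A - mat (complex_of_real c)) = complex_of_real (det (A - mat c))"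
    by (simp add: det_2 complexify_def mat_def)
  then have "complex_of_real c \<in> {r, s}"
    using assms unfolding rs(1)[symmetric] by (simp add: eigenvalue_iff_det)
  then have "cmod (complex_of_real c) \<le> max (cmod r) (cmod s)" by (elim insertE emptyE) (auto simp: le_max_iff_disj)
  then show ?thesis by (simp add: spectral_radius_def rs)
qed

section \<open>Singular values of a two by two matrix\<close>

text \<open>Both facts come from diagonalising the Gram matrix, with entries \<open>P\<close>, \<open>Q\<close>, \<open>Q\<close>, \<open>R\<close>: its
  eigenvalues \<open>t1 \<ge> t2\<close> are the squares of the singular values.\<close>
lemma
  fixes A :: "real^2^2"
  shows sigma_mult: "sigma1 A * sigma2 A = \<bar>det A\<bar>"
    and norm_le_sigma1: "(norm (A *v v))\<^sup>2 \<le> (sigma1 A)\<^sup>2 * (norm v)\<^sup>2"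
proof -
  define P where "P = (A $ 1 $ 1)\<^sup>2 + (A $ 2 $ 1)\<^sup>2"
  define Q where "Q = A $ 1 $ 1 * A $ 1 $ 2 + A $ 2 $ 1 * A $ 2 $ 2"
  define R where "R = (A $ 1 $ 2)\<^sup>2 + (A $ 2 $ 2)\<^sup>2"
  define w where "w = sqrt (((P - R) / 2)\<^sup>2 + Q\<^sup>2)"
  define t1 where "t1 = (P + R) / 2 + w"
  define t2 where "t2 = (P + R) / 2 - w"
  have w2: "w\<^sup>2 = ((P - R) / 2)\<^sup>2 + Q\<^sup>2" by (simp add: w_def)
  have w0: "0 \<le> w" by (simp add: w_def)
  have PR: "P * R - Q\<^sup>2 = (det A)\<^sup>2"
    by (simp add: P_def Q_def R_def det_2 power2_eq_square algebra_simps)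
  have t12: "t1 * t2 = (det A)\<^sup>2"
  proof -
    have "t1 * t2 = ((P + R) / 2)\<^sup>2 - w\<^sup>2" by (simp add: t1_def t2_def power2_eq_square algebra_simps)
    also have "\<dots> = P * R - Q\<^sup>2" unfolding w2 by (simp add: power2_eq_square field_simps)
    finally show ?thesis using PR by simp
  qed
  have P0: "0 \<le> P" "0 \<le> R" by (auto simp: P_def R_def)
  have wabs: "\<bar>(P - R) / 2\<bar> \<le> w" unfolding w_def by (rule real_sqrt_ge_abs1)
  have t1: "P \<le> t1" "R \<le> t1" using wabs by (auto simp: t1_def field_simps)
  have t1_0: "0 \<le> t1" "t2 \<le> t1" using t1 P0 w0 by (auto simp: t1_def t2_def)
  have t2_0: "0 \<le> t2"
  proof -
    have "w\<^sup>2 \<le> ((P + R) / 2)\<^sup>2"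
    proof -
      have "((P + R) / 2)\<^sup>2 - w\<^sup>2 = P * R - Q\<^sup>2" unfolding w2 by (simp add: power2_eq_square field_simps)
      then show ?thesis using PR zero_le_power2[of "det A"] by linarith
    qed
    then have "w \<le> (P + R) / 2" by (rule power2_le_imp_le) (use P0 in auto)
    then show ?thesis by (simp add: t2_def)
  qed
  have M: "(transpose A ** A) $ 1 $ 1 = P" "(transpose A ** A) $ 1 $ 2 = Q"
    "(transpose A ** A) $ 2 $ 1 = Q" "(transpose A ** A) $ 2 $ 2 = R"
    by (simp_all add: matrix_matrix_mult_def transpose_def sum_2 P_def Q_def R_def power2_eq_square)
  have "det (transpose A ** A - mat t) = (t - t1) * (t - t2)" for t
  proof -
    have "(t - t1) * (t - t2) = (t - (P + R) / 2)\<^sup>2 - w\<^sup>2"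
      by (simp add: t1_def t2_def power2_eq_square field_simps)
    also have "\<dots> = (P - t) * (R - t) - Q\<^sup>2"
      unfolding w2 by (simp add: power2_eq_square field_simps)
    finally show ?thesis
      by (simp add: det_2 mat_def M power2_eq_square)
  qed
  then have "singular_values A = {s. 0 \<le> s \<and> (s\<^sup>2 = t1 \<or> s\<^sup>2 = t2)}"
    by (auto simp: singular_values_def eigenvalue_iff_det)
  also have "\<dots> = {sqrt t1, sqrt t2}"
    using t1_0 t2_0 by auto
  finally have s: "sigma1 A = sqrt t1" "sigma2 A = sqrt t2"
    using t1_0 by (auto simp: sigma1_def sigma2_def)
  show "sigma1 A * sigma2 A = \<bar>det A\<bar>"
    unfolding s real_sqrt_mult[symmetric] t12 by simp
  have Q: "(t1 - P) * (t1 - R) = Q\<^sup>2"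
  proof -
    have "(t1 - P) * (t1 - R) = w\<^sup>2 - ((P - R) / 2)\<^sup>2" by (simp add: t1_def power2_eq_square field_simps)
    then show ?thesis by (simp add: w2)
  qed
  define x where "x = v $ 1"
  define y where "y = v $ 2"
  \<comment> \<open>subtracting the Gram matrix from \<open>t1\<close> times the identity leaves a singular matrix, so \<open>Q\<close> is the geometric mean of the diagonal entries up to sign\<close>
  have "(2 * Q * x * y)\<^sup>2 \<le> ((t1 - P) * x\<^sup>2 + (t1 - R) * y\<^sup>2)\<^sup>2"
  proof -
    have "((t1 - P) * x\<^sup>2 + (t1 - R) * y\<^sup>2)\<^sup>2 - (2 * Q * x * y)\<^sup>2 =
        ((t1 - P) * x\<^sup>2 + (t1 - R) * y\<^sup>2)\<^sup>2 - 4 * ((t1 - P) * (t1 - R)) * x\<^sup>2 * y\<^sup>2"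
      unfolding Q by (simp add: power_mult_distrib)
    also have "\<dots> = ((t1 - P) * x\<^sup>2 - (t1 - R) * y\<^sup>2)\<^sup>2"
      by (simp add: power2_eq_square algebra_simps)
    finally show ?thesis by (metis diff_ge_0_iff_ge zero_le_power2)
  qed
  then have "2 * Q * x * y \<le> (t1 - P) * x\<^sup>2 + (t1 - R) * y\<^sup>2"
    by (rule power2_le_imp_le) (use t1 in auto)
  then have "P * x\<^sup>2 + 2 * Q * x * y + R * y\<^sup>2 \<le> t1 * (x\<^sup>2 + y\<^sup>2)"
    by (simp add: algebra_simps)
  moreover have norm_sq: "(norm z)\<^sup>2 = (z $ 1)\<^sup>2 + (z $ 2)\<^sup>2" for z :: "real^2"
    by (simp only: power2_norm_eq_inner inner_vec_def sum_2) (simp add: power2_eq_square)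
  moreover have "(norm (A *v v))\<^sup>2 = P * x\<^sup>2 + 2 * Q * x * y + R * y\<^sup>2"
    unfolding norm_sq by (simp add: sum_2 matrix_vector_mult_def P_def Q_def R_def x_def y_def power2_eq_square algebra_simps)
  moreover have "(norm v)\<^sup>2 = x\<^sup>2 + y\<^sup>2"
    unfolding norm_sq x_def y_def ..
  ultimately show "(norm (A *v v))\<^sup>2 \<le> (sigma1 A)\<^sup>2 * (norm v)\<^sup>2"
    using t1_0 by (simp add: s)
qed

text \<open>The ratio of singular values is the determinant over the squared norm, so growth of a single vector
  beyond the square root of the determinant bounds it.\<close>
lemma sigma_ratio_le:
  fixes A :: "real^2^2"
  assumes "A *v v \<noteq> 0"
  shows "sigma2 A / sigma1 A \<le> \<bar>det A\<bar> * (norm v)\<^sup>2 / (norm (A *v v))\<^sup>2"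
proof -
  have p: "0 < (norm (A *v v))\<^sup>2" using assms by simp
  have s: "sigma1 A \<noteq> 0" using norm_le_sigma1[of A v] p by auto
  then have "sigma2 A / sigma1 A = \<bar>det A\<bar> / (sigma1 A)\<^sup>2"
    unfolding sigma_mult[symmetric] by (simp add: power2_eq_square)
  also have "\<dots> \<le> \<bar>det A\<bar> * (norm v)\<^sup>2 / (norm (A *v v))\<^sup>2"
  proof -
    have "\<bar>det A\<bar> * (norm (A *v v))\<^sup>2 \<le> \<bar>det A\<bar> * ((sigma1 A)\<^sup>2 * (norm v)\<^sup>2)"
      using norm_le_sigma1 by (intro mult_left_mono) auto
    then show ?thesis using s p by (simp add: divide_simps mult_ac)
  qed
  finally show ?thesis .
qed

section \<open>Moebius maps acting on slopes\<close>

text \<open>In a basis \<open>u\<close>, \<open>s\<close> let the letter \<open>i\<close> send \<open>u\<close> to \<open>a i u + c i s\<close> and \<open>s\<close> to \<open>b i u + d i s\<close>.  It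
  maps the direction of slope \<open>z\<close> to the direction of slope \<open>(c i + d i z) / (a i + b i z)\<close>, with a pole
  where the image is parallel to \<open>s\<close>.  The letter \<open>1\<close> is diagonal and contracts slopes.  The
  assumption \<open>pole\<close> says that no other letter fixes the direction of \<open>s\<close>; otherwise its slope map
  would be affine, possibly expanding, and slopes could escape to infinity.\<close>
locale slope_maps =
  fixes I :: "nat set" and a b c d :: "nat \<Rightarrow> real"
  assumes finite_I: "finite I"
    and det_pos: "\<And>i. i \<in> I \<Longrightarrow> 0 < a i * d i - b i * c i"
    and diagonal: "b 1 = 0" "c 1 = 0" "0 < d 1 / a 1" "d 1 / a 1 < 1"
    and pole: "\<And>i. i \<in> I \<Longrightarrow> i \<noteq> 1 \<Longrightarrow> b i \<noteq> 0"
begin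

text \<open>The slope reached by a word, read from the right, whose letters are each followed by the translation
  by \<open>t\<close>.  The initial value is the fixed point of the perturbed letter \<open>1\<close>.\<close>
primrec slope :: "real \<Rightarrow> nat list \<Rightarrow> real" where
  "slope t [] = t / (1 - d 1 / a 1)"
| "slope t (i # w) = t + (c i + d i * slope t w) / (a i + b i * slope t w)"

text \<open>The first coordinate of the image of \<open>u\<close> under an unperturbed word.\<close>
primrec stretch :: "nat list \<Rightarrow> real" where
  "stretch [] = 1"
| "stretch (i # w) = (a i + b i * slope 0 w) * stretch w"

end

lemma moebius_diff:
  fixes a b c d X Y :: real
  assumes "a + b * X \<noteq> 0" "a + b * Y \<noteq> 0"
  shows "(c + d * Y) / (a + b * Y) - (c + d * X) / (a + b * X) =
    (a * d - b * c) * (Y - X) / ((a + b * X) * (a + b * Y))"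
  using assms by (simp add: divide_simps) (simp add: algebra_simps)

text \<open>For \<open>X < m < Y\<close>, the expression \<open>1 / (m - X) + 1 / (Y - m)\<close> is the density at \<open>m\<close> of the Hilbert
  metric of the interval from \<open>X\<close> to \<open>Y\<close>.  The lemma is its invariance under projective maps, the
  derivative of \<open>g\<close> at \<open>m\<close> being the determinant over \<open>(a + b m)\<^sup>2\<close>.\<close>
lemma moebius_hilbert_density:
  fixes a b c d X m Y :: real
  defines "g \<equiv> \<lambda>z. (c + d * z) / (a + b * z)"
  assumes nz: "a + b * X \<noteq> 0" "a + b * m \<noteq> 0" "a + b * Y \<noteq> 0"
    and "X \<noteq> m" "m \<noteq> Y" "a * d - b * c \<noteq> 0"
  shows "(a * d - b * c) * (1 / (g m - g X) + 1 / (g Y - g m)) =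
    (a + b * m)\<^sup>2 * (1 / (m - X) + 1 / (Y - m))"
proof -
  define D where "D = a * d - b * c"
  have D: "D \<noteq> 0" using assms by (simp add: D_def)
  have 1: "D * (1 / (g m - g X)) = (a + b * m) * ((a + b * X) / (m - X))"
    unfolding g_def moebius_diff[OF nz(1,2)] D_def[symmetric] using D by simp
  have 2: "D * (1 / (g Y - g m)) = (a + b * m) * ((a + b * Y) / (Y - m))"
    unfolding g_def moebius_diff[OF nz(2,3)] D_def[symmetric] using D by simp
  have 3: "(a + b * X) / (m - X) = (a + b * m) / (m - X) - b"
    using assms by (simp add: field_simps)
  have 4: "(a + b * Y) / (Y - m) = (a + b * m) / (Y - m) + b"
    using assms by (simp add: field_simps)
  show ?thesis
    unfolding D_def[symmetric] distrib_left[of D] 1 2 3 4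
    by (simp add: power2_eq_square algebra_simps add_divide_distrib diff_divide_distrib)
qed

text \<open>Moving an end point away by \<open>\<delta>\<close> lowers its term of the Hilbert density by a factor which is uniform
  as long as the new distance is at most \<open>2 M\<close>.\<close>
lemma enlarged_gap:
  fixes p \<delta> M :: real
  assumes "0 < p" "0 < \<delta>" "p + \<delta> \<le> 2 * M"
  shows "1 / (p + \<delta>) \<le> (1 - \<delta> / (2 * M)) * (1 / p)"
proof -
  have M: "M > 0" using assms by auto
  have "1 - \<delta> / (p + \<delta>) \<le> 1 - \<delta> / (2 * M)"
    using assms by (simp add: frac_le)
  then have "(1 - \<delta> / (p + \<delta>)) * (1 / p) \<le> (1 - \<delta> / (2 * M)) * (1 / p)"
    using assms by (intro mult_right_mono) auto
  moreover have "1 / (p + \<delta>) = (1 - \<delta> / (p + \<delta>)) * (1 / p)"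
    using assms by (simp add: field_simps)
  ultimately show ?thesis by simp
qed

text \<open>Absence of connections: no word perturbed by a parameter of modulus at most \<open>2 \<delta>\<close> sends its initial
  direction to \<open>s\<close>.  The margin between \<open>2 \<delta>\<close> and the range \<open>\<delta>\<close> used for the intervals below keeps
  slopes away from the poles.\<close>
locale disconnected_slope_maps = slope_maps +
  fixes \<delta> :: real
  assumes \<delta>: "0 < \<delta>"
    and no_pole: "\<And>t i w. \<lbrakk>\<bar>t\<bar> \<le> 2 * \<delta>; i \<in> I; w \<in> lists I\<rbrakk> \<Longrightarrow> a i + b i * slope t w \<noteq> 0"
begin

lemma continuous_slope:
  assumes "w \<in> lists I" and "- (2 * \<delta>) \<le> p" "q \<le> 2 * \<delta>"
  shows "continuous_on {p..q} (\<lambda>t. slope t w)"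
  using assms(1)
proof (induction w)
  case Nil
  show ?case using diagonal by (auto intro!: continuous_intros)
next
  case (Cons i w)
  have "\<forall>t\<in>{p..q}. a i + b i * slope t w \<noteq> 0"
    using Cons assms no_pole[of _ i w] by auto
  with Cons show ?case by (auto intro!: continuous_intros)
qed

text \<open>By continuity in the parameter, a slope cannot cross a pole without hitting it.\<close>
lemma slope_neq_pole:
  assumes "p \<le> q" "- (2 * \<delta>) \<le> p" "q \<le> 2 * \<delta>" "w \<in> lists I" "i \<in> I" "b i \<noteq> 0"
  shows "slope q w < - a i / b i \<or> - a i / b i < slope p w"
proof (rule ccontr)
  assume *: "\<not> ?thesis"
  have "\<exists>t\<ge>p. t \<le> q \<and> slope t w = - a i / b i"
    by (rule IVT') (use assms * continuous_slope in auto)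
  then obtain t where t: "p \<le> t" "t \<le> q" "slope t w = - a i / b i" by auto
  then have "\<bar>t\<bar> \<le> 2 * \<delta>" using assms by linarith
  then show False using no_pole[of t i w] assms t by auto
qed

lemma denominators_same_sign:
  assumes "p \<le> q" "- (2 * \<delta>) \<le> p" "q \<le> 2 * \<delta>" "w \<in> lists I" "i \<in> I"
    and "slope p w \<le> slope q w"
  shows "0 < (a i + b i * slope p w) * (a i + b i * slope q w)"
proof (cases "b i = 0")
  case True
  have "\<bar>p\<bar> \<le> 2 * \<delta>" using assms by linarith
  then have "a i \<noteq> 0" using no_pole[of p i w] assms True by auto
  then show ?thesis using True by (simp add: zero_less_mult_iff linorder_neq_iff disj_commute)
next
  case False
  have e: "a i + b i * z = b i * (z - - a i / b i)" for z
    using False by (simp add: field_simps)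
  have "0 < (slope p w - - a i / b i) * (slope q w - - a i / b i)"
    using slope_neq_pole[OF assms(1-5) False] assms(6)
    by (auto intro: mult_pos_pos mult_neg_neg)
  moreover have "(a i + b i * slope p w) * (a i + b i * slope q w) =
      (b i)\<^sup>2 * ((slope p w - - a i / b i) * (slope q w - - a i / b i))"
    unfolding e power2_eq_square by (simp only: mult_ac)
  ultimately show ?thesis using False by simp
qed

text \<open>Each translation contributes the parameter itself, and the Moebius maps are increasing between their
  poles.\<close>
lemma slope_increases:
  assumes "p \<le> q" "- (2 * \<delta>) \<le> p" "q \<le> 2 * \<delta>" "w \<in> lists I"
  shows "q - p \<le> slope q w - slope p w"
  using assms(4)
proof (induction w)
  case Nil
  have "(q - p) * (1 - d 1 / a 1) \<le> q - p"
    using assms diagonal by (intro mult_left_le) auto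
  then show ?case
    using diagonal by (simp add: diff_divide_distrib[symmetric] pos_le_divide_eq)
next
  case (Cons i w)
  then have i: "i \<in> I" "w \<in> lists I" and le: "slope p w \<le> slope q w"
    using assms by auto
  have nz: "a i + b i * slope p w \<noteq> 0" "a i + b i * slope q w \<noteq> 0"
    using no_pole assms i by auto
  have "0 \<le> (a i * d i - b i * c i) * (slope q w - slope p w) /
      ((a i + b i * slope p w) * (a i + b i * slope q w))"
    using denominators_same_sign[OF assms(1-3) i(2,1) le] det_pos[OF i(1)] le by simp
  then show ?case using moebius_diff[OF nz, of "c i" "d i"] by simp
qed

text \<open>Slopes move at least as fast as the parameter and cannot cross a pole while it varies by \<open>\<delta>\<close>.  So
  they keep the distance \<open>\<delta>\<close> from the poles, and the Moebius maps of the letters other than \<open>1\<close> are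
  bounded there.  The letter \<open>1\<close> preserves every bound from \<open>\<delta> / (1 - d 1 / a 1)\<close> on.\<close>
lemma slope_bounded:
  obtains M where "\<And>t w. \<lbrakk>\<bar>t\<bar> \<le> \<delta>; w \<in> lists I\<rbrakk> \<Longrightarrow> \<bar>slope t w\<bar> \<le> M"
proof
  define \<kappa> where "\<kappa> = d 1 / a 1"
  have \<kappa>: "0 < \<kappa>" "\<kappa> < 1" using diagonal by (auto simp: \<kappa>_def)
  define e where "e i = \<delta> + \<bar>d i / b i\<bar> + (a i * d i - b i * c i) / ((b i)\<^sup>2 * \<delta>)" for i
  define M where "M = \<delta> / (1 - \<kappa>) + (\<Sum>i\<in>I - {1}. e i)"
  have e0: "0 \<le> e i" if "i \<in> I" for i
    using \<delta> det_pos[OF that] by (simp add: e_def)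
  have sum0: "0 \<le> (\<Sum>i\<in>I - {1}. e i)" using e0 by (intro sum_nonneg) auto
  have M1: "\<delta> / (1 - \<kappa>) \<le> M" using sum0 by (simp add: M_def)
  have M2: "e i \<le> M" if "i \<in> I" "i \<noteq> 1" for i
  proof -
    have "e i \<le> (\<Sum>i\<in>I - {1}. e i)"
      using that e0 finite_I by (intro member_le_sum) auto
    moreover have "0 \<le> \<delta> / (1 - \<kappa>)" using \<delta> \<kappa> by auto
    ultimately show ?thesis by (simp add: M_def)
  qed
  fix t w assume t: "\<bar>t\<bar> \<le> \<delta>" and w: "w \<in> lists I"
  show "\<bar>slope t w\<bar> \<le> M"
    using w
  proof (induction w)
    case Nil
    have "\<bar>slope t []\<bar> = \<bar>t\<bar> / (1 - \<kappa>)" using \<kappa> by (simp add: \<kappa>_def)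
    also have "\<dots> \<le> \<delta> / (1 - \<kappa>)" using t \<kappa> by (intro divide_right_mono) auto
    finally show ?case using M1 by simp
  next
    case (Cons i w)
    then have i: "i \<in> I" "w \<in> lists I" and IH: "\<bar>slope t w\<bar> \<le> M" by auto
    show ?case
    proof (cases "i = 1")
      case True
      have a1: "a 1 \<noteq> 0" using diagonal by auto
      have "\<delta> + \<kappa> * M \<le> M"
        using M1 \<kappa> by (simp add: pos_divide_le_eq algebra_simps)
      moreover have "slope t (i # w) = t + \<kappa> * slope t w"
        using True diagonal by (simp add: \<kappa>_def)
      moreover have "\<bar>\<kappa> * slope t w\<bar> \<le> \<kappa> * M"
        using IH \<kappa> by (simp add: abs_mult)
      ultimately show ?thesis using t by linarith
    next
      case False
      then have bi: "b i \<noteq> 0" using pole i by auto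
      define z where "z = slope t w"
      define D where "D = a i * d i - b i * c i"
      have h: "a i + b i * z \<noteq> 0" using no_pole[of t i w] t \<delta> i by (auto simp: z_def)
      have "\<delta> \<le> \<bar>z - - a i / b i\<bar>"
      proof -
        have r: "- (2 * \<delta>) \<le> t" "t + \<delta> \<le> 2 * \<delta>" "- (2 * \<delta>) \<le> t - \<delta>" "t \<le> 2 * \<delta>"
          using t \<delta> by linarith+
        have "slope t w + \<delta> \<le> - a i / b i \<or> - a i / b i < slope t w"
          using slope_neq_pole[of t "t + \<delta>" w i] slope_increases[of t "t + \<delta>" w] r \<delta> i bi by auto
        moreover have "slope t w < - a i / b i \<or> - a i / b i \<le> slope t w - \<delta>"
          using slope_neq_pole[of "t - \<delta>" t w i] slope_increases[of "t - \<delta>" t w] r \<delta> i bi by auto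
        ultimately show ?thesis unfolding z_def by linarith
      qed
      then have "\<bar>b i\<bar> * \<delta> \<le> \<bar>b i\<bar> * \<bar>z - - a i / b i\<bar>" by (intro mult_left_mono) auto
      also have "\<dots> = \<bar>a i + b i * z\<bar>"
        using bi by (simp add: abs_mult[symmetric] algebra_simps)
      finally have far: "\<bar>b i\<bar> * \<delta> \<le> \<bar>a i + b i * z\<bar>" .
      have "(c i + d i * z) / (a i + b i * z) = d i / b i - D / (b i * (a i + b i * z))"
      proof -
        define k where "k = a i + b i * z"
        have "d i * k - D = b i * (c i + d i * z)" by (simp add: D_def k_def algebra_simps)
        then have "(c i + d i * z) / k = (d i * k - D) / (b i * k)" using bi by simp
        also have "\<dots> = d i / b i - D / (b i * k)" using bi h by (simp add: k_def[symmetric] diff_divide_distrib)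
        finally show ?thesis by (simp add: k_def)
      qed
      then have "\<bar>(c i + d i * z) / (a i + b i * z)\<bar> \<le> \<bar>d i / b i\<bar> + \<bar>D / (b i * (a i + b i * z))\<bar>"
        by linarith
      moreover have "\<bar>D / (b i * (a i + b i * z))\<bar> \<le> D / ((b i)\<^sup>2 * \<delta>)"
      proof -
        have "(b i)\<^sup>2 * \<delta> = \<bar>b i\<bar> * (\<bar>b i\<bar> * \<delta>)"
          by (simp add: power2_eq_square)
        also have "\<dots> \<le> \<bar>b i\<bar> * \<bar>a i + b i * z\<bar>"
          using far by (intro mult_left_mono) auto
        finally have "(b i)\<^sup>2 * \<delta> \<le> \<bar>b i * (a i + b i * z)\<bar>" by (simp add: abs_mult)
        then show ?thesis
          using det_pos[OF i(1)] bi \<delta> unfolding abs_divide D_def[symmetric]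
          by (simp add: frac_le)
      qed
      moreover have "slope t (i # w) = t + (c i + d i * z) / (a i + b i * z)"
        by (simp add: z_def)
      ultimately have "\<bar>slope t (i # w)\<bar> \<le> e i"
        using t unfolding e_def D_def[symmetric] by linarith
      then show ?thesis using M2[OF i(1) False] by simp
    qed
  qed
qed

text \<open>Taken at the unperturbed slope, in the interval swept by the parameters between \<open>- \<delta>\<close> and \<open>\<delta>\<close>.\<close>
definition hilbert_density :: "nat list \<Rightarrow> real" where
  "hilbert_density w = 1 / (slope 0 w - slope (- \<delta>) w) + 1 / (slope \<delta> w - slope 0 w)"

text \<open>One letter transports the density by projective invariance; the translations by \<open>- \<delta>\<close> and \<open>\<delta>\<close> then
  enlarge the interval at both ends.\<close>
lemma hilbert_density_contracts:
  assumes M: "\<And>t w. \<lbrakk>\<bar>t\<bar> \<le> \<delta>; w \<in> lists I\<rbrakk> \<Longrightarrow> \<bar>slope t w\<bar> \<le> M"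
    and i: "i \<in> I" "w \<in> lists I"
  shows "(a i * d i - b i * c i) * hilbert_density (i # w) \<le>
    (1 - \<delta> / (2 * M)) * (a i + b i * slope 0 w)\<^sup>2 * hilbert_density w"
proof -
  define g where "g z = (c i + d i * z) / (a i + b i * z)" for z
  define X where "X = slope (- \<delta>) w"
  define m where "m = slope 0 w"
  define Y where "Y = slope \<delta> w"
  define \<tau> where "\<tau> = 1 - \<delta> / (2 * M)"
  define D where "D = a i * d i - b i * c i"
  have D: "0 < D" using det_pos i by (simp add: D_def)
  have Xm: "X < m" "m < Y"
    using slope_increases[of "- \<delta>" 0 w] slope_increases[of 0 \<delta> w] \<delta> i by (auto simp: X_def m_def Y_def)
  have nz: "a i + b i * X \<noteq> 0" "a i + b i * m \<noteq> 0" "a i + b i * Y \<noteq> 0"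
    using no_pole i \<delta> by (auto simp: X_def m_def Y_def)
  have s: "slope (- \<delta>) (i # w) = g X - \<delta>" "slope 0 (i # w) = g m" "slope \<delta> (i # w) = g Y + \<delta>"
    by (simp_all add: g_def X_def m_def Y_def)
  have iw: "i # w \<in> lists I" using i by auto
  have g1: "0 < g m - g X"
    unfolding g_def moebius_diff[OF nz(1,2)]
    using denominators_same_sign[of "- \<delta>" 0 w i] i \<delta> Xm D by (simp add: X_def m_def D_def)
  have g2: "0 < g Y - g m"
    unfolding g_def moebius_diff[OF nz(2,3)]
    using denominators_same_sign[of 0 \<delta> w i] i \<delta> Xm D by (simp add: Y_def m_def D_def)
  have b: "\<bar>g X - \<delta>\<bar> \<le> M" "\<bar>g m\<bar> \<le> M" "\<bar>g Y + \<delta>\<bar> \<le> M"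
    using M[OF _ iw, of "- \<delta>"] M[OF _ iw, of 0] M[OF _ iw, of \<delta>] \<delta> unfolding s by auto
  have "1 / (g m - g X + \<delta>) \<le> \<tau> * (1 / (g m - g X))" "1 / (g Y - g m + \<delta>) \<le> \<tau> * (1 / (g Y - g m))"
    unfolding \<tau>_def using b by (intro enlarged_gap g1 g2 \<delta>; linarith)+
  then have "hilbert_density (i # w) \<le> \<tau> * (1 / (g m - g X) + 1 / (g Y - g m))"
    unfolding hilbert_density_def s by (simp add: algebra_simps)
  then have "D * hilbert_density (i # w) \<le> D * (\<tau> * (1 / (g m - g X) + 1 / (g Y - g m)))"
    using D by (intro mult_left_mono) auto
  also have "\<dots> = \<tau> * (D * (1 / (g m - g X) + 1 / (g Y - g m)))" by simp
  also have "D * (1 / (g m - g X) + 1 / (g Y - g m)) = (a i + b i * m)\<^sup>2 * (1 / (m - X) + 1 / (Y - m))"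
    unfolding D_def g_def using moebius_hilbert_density[OF nz, where c = "c i" and d = "d i"] Xm D by (simp add: D_def)
  finally show ?thesis
    by (simp add: \<tau>_def D_def hilbert_density_def m_def X_def Y_def mult.assoc)
qed

text \<open>Multiplying the contraction along a word telescopes the derivatives \<open>(a i * d i - b i * c i) /
  (a i + b i * slope 0 w)\<^sup>2\<close> into the determinant over the squared stretch.  The density of the empty word
  is a constant, and boundedness of the slopes bounds the density of every word from below.\<close>
lemma prod_det_le_stretch:
  obtains C \<tau> where "0 < \<tau>" "\<tau> < 1" "0 < C"
    "\<And>w. w \<in> lists I \<Longrightarrow> (\<Prod>i\<leftarrow>w. a i * d i - b i * c i) \<le> C * \<tau> ^ length w * (stretch w)\<^sup>2"
proof -
  obtain M where M: "\<And>t w. \<lbrakk>\<bar>t\<bar> \<le> \<delta>; w \<in> lists I\<rbrakk> \<Longrightarrow> \<bar>slope t w\<bar> \<le> M"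
    using slope_bounded by blast
  define \<tau> where "\<tau> = 1 - \<delta> / (2 * M)"
  have gap: "\<delta> \<le> slope 0 w - slope (- \<delta>) w" "slope 0 w - slope (- \<delta>) w \<le> 2 * M"
    "\<delta> \<le> slope \<delta> w - slope 0 w" "slope \<delta> w - slope 0 w \<le> 2 * M" if "w \<in> lists I" for w
    using slope_increases[of "- \<delta>" 0 w] slope_increases[of 0 \<delta> w] \<delta> that M[of "-\<delta>" w] M[of \<delta> w] M[of 0 w]
    by auto
  have M\<delta>: "\<delta> \<le> M" "0 < M" 
    using slope_increases[of "- \<delta>" \<delta> "[]"] M[of "- \<delta>" "[]"] M[of \<delta> "[]"] \<delta> by (auto simp del: slope.simps)
  have \<tau>: "0 < \<tau>" "\<tau> < 1" using M\<delta> \<delta> by (auto simp: \<tau>_def field_simps)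
  have H: "1 / M \<le> hilbert_density w" if "w \<in> lists I" for w
  proof -
    have "1 / (2 * M) \<le> 1 / (slope 0 w - slope (- \<delta>) w)" "1 / (2 * M) \<le> 1 / (slope \<delta> w - slope 0 w)"
      using gap[OF that] \<delta> by (intro divide_left_mono mult_pos_pos; linarith)+
    then show ?thesis by (simp add: hilbert_density_def)
  qed
  have main: "(\<Prod>i\<leftarrow>w. a i * d i - b i * c i) * hilbert_density w \<le> \<tau> ^ length w * (stretch w)\<^sup>2 * hilbert_density []"
    if "w \<in> lists I" for w
    using that
  proof (induction w)
    case (Cons i w)
    then have i: "i \<in> I" "w \<in> lists I" by auto
    define P where "P = (\<Prod>i\<leftarrow>w. a i * d i - b i * c i)"
    have P: "0 \<le> P" unfolding P_def using i det_pos by (intro prod_list_nonneg) (auto intro: less_imp_le)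
    have "(\<Prod>i\<leftarrow>i # w. a i * d i - b i * c i) * hilbert_density (i # w) =
        P * ((a i * d i - b i * c i) * hilbert_density (i # w))" by (simp add: P_def)
    also have "\<dots> \<le> P * (\<tau> * (a i + b i * slope 0 w)\<^sup>2 * hilbert_density w)"
      using hilbert_density_contracts[OF M i] P by (intro mult_left_mono) (auto simp: \<tau>_def)
    also have "\<dots> = \<tau> * (a i + b i * slope 0 w)\<^sup>2 * (P * hilbert_density w)" by simp
    also have "\<dots> \<le> \<tau> * (a i + b i * slope 0 w)\<^sup>2 * (\<tau> ^ length w * (stretch w)\<^sup>2 * hilbert_density [])"
      using Cons i \<tau> by (intro mult_left_mono) (auto simp: P_def)
    finally show ?case by (simp add: power_mult_distrib mult_ac)
  qed simp
  show ?thesis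
  proof (rule that[OF \<tau>])
    show "0 < M * hilbert_density []"
      using H[of "[]"] M\<delta> by (intro mult_pos_pos) (auto intro: less_le_trans[of _ "1 / M"])
    fix w assume w: "w \<in> lists I"
    define P where "P = (\<Prod>i\<leftarrow>w. a i * d i - b i * c i)"
    have P: "0 \<le> P" unfolding P_def using w det_pos by (intro prod_list_nonneg) (auto intro: less_imp_le)
    have "P * (1 / M) \<le> P * hilbert_density w" using H[OF w] P by (intro mult_left_mono) auto
    also note main[OF w, folded P_def]
    finally show "P \<le> M * hilbert_density [] * \<tau> ^ length w * (stretch w)\<^sup>2"
      using M\<delta> by (simp add: pos_divide_le_eq mult_ac)
  qed
qed

end

section \<open>Shears, connections and domination\<close>

lemma wedge_simps:
  "wedge (x + y) z = wedge x z + wedge y z" "wedge z (x + y) = wedge z x + wedge z y"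
  "wedge (c *\<^sub>R x) y = c * wedge x y" "wedge x (c *\<^sub>R y) = c * wedge x y"
  "wedge x x = 0"
  by (simp_all add: wedge_def algebra_simps)

text \<open>Cramer's rule.\<close>
lemma wedge_basis:
  assumes "wedge u s = 1"
  shows "v = wedge v s *\<^sub>R u + wedge u v *\<^sub>R s"
proof -
  have "v $ i * wedge u s = (wedge v s *\<^sub>R u + wedge u v *\<^sub>R s) $ i" for i
    using exhaust_2[of i] by (auto simp: wedge_def algebra_simps)
  then show ?thesis using assms by (simp add: vec_eq_iff)
qed

text \<open>The matrix of \<open>v \<mapsto> v + t (v \<and> s) s\<close>, which fixes \<open>s\<close> and adds \<open>t\<close> to slopes if \<open>u \<and> s = 1\<close>.\<close>
definition shear :: "real^2 \<Rightarrow> real \<Rightarrow> real^2^2" where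
  "shear s t = mat 1 + t *\<^sub>R
    vector [vector [s $ 1 * s $ 2, - (s $ 1 * s $ 1)], vector [s $ 2 * s $ 2, - (s $ 1 * s $ 2)]]"

lemma shear_mult: "shear s t *v v = v + (t * wedge v s) *\<^sub>R s"
  by (simp add: vec_eq_iff forall_2 shear_def matrix_vector_mult_def sum_2 mat_def wedge_def algebra_simps)

lemma det_shear [simp]: "det (shear s t) = 1"
  by (simp add: det_2 shear_def mat_def algebra_simps)

lemma shear_0 [simp]: "shear s 0 = mat 1"
  by (simp add: shear_def)

lemma continuous_on_shear [continuous_intros]: "continuous_on S (shear s)"
  unfolding shear_def by (intro continuous_intros)

text \<open>Translates the estimate on slopes back to matrices.  The shifted vector \<open>u + (t / (1 - m / l)) s\<close> is
  the expanding eigenvector of the sheared first letter.  Up to a constant, \<open>u\<close> is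
  stretched at least as much as its first coordinate, so the bound on determinants becomes one on the ratio of singular values.\<close>
lemma no_connection_imp_one_dominated:
  fixes A :: "nat \<Rightarrow> real^2^2"
  assumes I: "finite I"
    and det: "\<And>i. i \<in> I \<Longrightarrow> 0 < det (A i)"
    and us: "wedge u s = 1" "A 1 *v u = l *\<^sub>R u" "A 1 *v s = m *\<^sub>R s" "0 < m / l" "m / l < 1"
    and pole: "\<And>i. \<lbrakk>i \<in> I; i \<noteq> 1\<rbrakk> \<Longrightarrow> wedge (A i *v s) s \<noteq> 0"
    and \<delta>: "0 < \<delta>"
    and no_connection: "\<And>t w. \<lbrakk>\<bar>t\<bar> \<le> 2 * \<delta>; w \<in> lists I\<rbrakk> \<Longrightarrow>
      wedge (matrix_prod (map (\<lambda>i. shear s t ** A i) w) *v (u + (t / (1 - m / l)) *\<^sub>R s)) s \<noteq> 0"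
  shows "one_dominated (A ` I)"
proof -
  define a where "a i = wedge (A i *v u) s" for i
  define b where "b i = wedge (A i *v s) s" for i
  define c where "c i = wedge u (A i *v u)" for i
  define d where "d i = wedge u (A i *v s)" for i
  have Au: "A i *v u = a i *\<^sub>R u + c i *\<^sub>R s" and As: "A i *v s = b i *\<^sub>R u + d i *\<^sub>R s" for i
    unfolding a_def b_def c_def d_def by (rule wedge_basis[OF us(1)])+
  have su: "wedge s u = - 1" using us(1) by (simp add: wedge_def algebra_simps)
  have det_eq: "det (A i) = a i * d i - b i * c i" for i
    using wedge_matrix[of "A i" u s] unfolding Au As by (simp add: wedge_simps us su mult.commute)
  have one: "a 1 = l" "b 1 = 0" "c 1 = 0" "d 1 = m"
    using us by (simp_all add: a_def b_def c_def d_def wedge_simps)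
  interpret slope_maps I a b c d
    using I det pole us(4,5) by unfold_locales (auto simp: det_eq one b_def[symmetric] simp del: One_nat_def)
  have step: "(shear s t ** A i) *v (x *\<^sub>R (u + z *\<^sub>R s)) =
      x *\<^sub>R ((a i + b i * z) *\<^sub>R u + (c i + d i * z + t * (a i + b i * z)) *\<^sub>R s)" for t i x z
  proof -
    have "A i *v (x *\<^sub>R (u + z *\<^sub>R s)) = x *\<^sub>R ((a i + b i * z) *\<^sub>R u + (c i + d i * z) *\<^sub>R s)"
      by (simp add: matrix_vector_right_distrib matrix_vector_mult_scaleR Au As algebra_simps)
    then show ?thesis
      unfolding matrix_vector_mul_assoc[symmetric] shear_mult by (simp add: wedge_simps us algebra_simps)
  qed
  \<comment> \<open>a vanishing denominator would make the word extended by the letter \<open>i\<close> a connection\<close>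
  have orbit: "\<exists>x. x \<noteq> 0 \<and> (t = 0 \<longrightarrow> x = stretch w) \<and>
      matrix_prod (map (\<lambda>i. shear s t ** A i) w) *v (u + (t / (1 - m / l)) *\<^sub>R s) =
        x *\<^sub>R (u + slope t w *\<^sub>R s)"
    and denom: "i \<in> I \<Longrightarrow> a i + b i * slope t w \<noteq> 0"
    if t: "\<bar>t\<bar> \<le> 2 * \<delta>" and w: "w \<in> lists I" for t w i
  proof -
    let ?B = "\<lambda>w. matrix_prod (map (\<lambda>i. shear s t ** A i) w) *v (u + (t / (1 - m / l)) *\<^sub>R s)"
    have cons: "?B (i # w) = (shear s t ** A i) *v ?B w" for i w
      by (simp add: matrix_vector_mul_assoc)
    have nonzero: "a i + b i * slope t w \<noteq> 0"
      if "?B w = x *\<^sub>R (u + slope t w *\<^sub>R s)" "w \<in> lists I" "i \<in> I" for x w i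
    proof -
      have "?B (i # w) = x *\<^sub>R ((a i + b i * slope t w) *\<^sub>R u + (c i + d i * slope t w + t * (a i + b i * slope t w)) *\<^sub>R s)"
        unfolding cons that(1) step ..
      then have "wedge (?B (i # w)) s = x * (a i + b i * slope t w)"
        by (simp only: wedge_simps us) simp
      then show ?thesis using no_connection[OF t, of "i # w"] that by auto
    qed
    show *: "\<exists>x. x \<noteq> 0 \<and> (t = 0 \<longrightarrow> x = stretch w) \<and> ?B w = x *\<^sub>R (u + slope t w *\<^sub>R s)"
      using w
    proof (induction w)
      case Nil
      show ?case by (intro exI[of _ 1]) (simp add: one del: One_nat_def)
    next
      case (Cons i w)
      then have i: "i \<in> I" "w \<in> lists I" by auto
      with Cons obtain x where x: "x \<noteq> 0" "t = 0 \<longrightarrow> x = stretch w" "?B w = x *\<^sub>R (u + slope t w *\<^sub>R s)"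
        by auto
      define h where "h = a i + b i * slope t w"
      have h: "h \<noteq> 0" using nonzero[OF x(3) i(2,1)] by (simp add: h_def)
      have "?B (i # w) = x *\<^sub>R (h *\<^sub>R u + (c i + d i * slope t w + t * h) *\<^sub>R s)"
        unfolding cons x(3) step h_def ..
      also have "c i + d i * slope t w + t * h = h * slope t (i # w)"
        using h by (simp add: h_def[symmetric] field_simps)
      finally have "?B (i # w) = (x * h) *\<^sub>R (u + slope t (i # w) *\<^sub>R s)"
        by (simp add: scaleR_add_right)
      then show ?case using x h by (intro exI[of _ "x * h"]) (auto simp: h_def)
    qed
    show "a i + b i * slope t w \<noteq> 0" if "i \<in> I"
      using * nonzero w that by blast
  qed
  interpret disconnected_slope_maps I a b c d \<delta>
    using \<delta> denom by unfold_locales auto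
  obtain C \<tau> where C: "0 < \<tau>" "\<tau> < 1" "0 < C"
    "\<And>w. w \<in> lists I \<Longrightarrow> (\<Prod>i\<leftarrow>w. a i * d i - b i * c i) \<le> C * \<tau> ^ length w * (stretch w)\<^sup>2"
    using prod_det_le_stretch by blast
  define K where "K = max 2 (C * (norm s)\<^sup>2 * (norm u)\<^sup>2)"
  have ratio: "sigma2 (matrix_prod Bs) / sigma1 (matrix_prod Bs) \<le> K * \<tau> ^ length Bs"
    if Bs: "set Bs \<subseteq> A ` I" for Bs
  proof -
    have "Bs \<in> lists (A ` I)" using Bs by auto
    then obtain w where w: "w \<in> lists I" "Bs = map A w" unfolding lists_image by auto
    define v where "v = matrix_prod Bs *v u"
    have v: "v = stretch w *\<^sub>R (u + slope 0 w *\<^sub>R s)" "stretch w \<noteq> 0"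
      using orbit[OF _ w(1), of 0] \<delta> by (auto simp: v_def w(2))
    have "wedge v s = stretch w" unfolding v by (simp add: wedge_simps us)
    then have "\<bar>stretch w\<bar> \<le> norm v * norm s" using abs_wedge_le by metis
    then have "(stretch w)\<^sup>2 \<le> (norm v * norm s)\<^sup>2"
      by (metis abs_le_square_iff abs_of_nonneg mult_nonneg_nonneg norm_ge_zero)
    then have st: "(stretch w)\<^sup>2 \<le> (norm v)\<^sup>2 * (norm s)\<^sup>2" by (simp add: power_mult_distrib)
    have v0: "v \<noteq> 0" using \<open>wedge v s = stretch w\<close> v(2) by (auto simp: wedge_def)
    have D: "det (matrix_prod Bs) = (\<Prod>i\<leftarrow>w. a i * d i - b i * c i)"
      by (simp add: det_matrix_prod w det_eq o_def)
    have D0: "0 \<le> det (matrix_prod Bs)"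
      unfolding det_matrix_prod using det Bs by (intro prod_list_nonneg) (auto intro: less_imp_le)
    have "det (matrix_prod Bs) \<le> C * \<tau> ^ length w * ((norm v)\<^sup>2 * (norm s)\<^sup>2)"
      unfolding D using C by (intro order_trans[OF C(4)[OF w(1)]] mult_left_mono st) auto
    then have "det (matrix_prod Bs) * (norm u)\<^sup>2 \<le> (C * \<tau> ^ length w * ((norm v)\<^sup>2 * (norm s)\<^sup>2)) * (norm u)\<^sup>2"
      by (intro mult_right_mono) auto
    then have "\<bar>det (matrix_prod Bs)\<bar> * (norm u)\<^sup>2 / (norm v)\<^sup>2 \<le> C * (norm s)\<^sup>2 * (norm u)\<^sup>2 * \<tau> ^ length w"
      using v0 D0 by (simp add: pos_divide_le_eq mult_ac)
    also have "\<dots> \<le> K * \<tau> ^ length w" using C by (intro mult_right_mono) (auto simp: K_def)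
    finally show ?thesis
      using sigma_ratio_le[of "matrix_prod Bs" u] v0 by (simp add: v_def w)
  qed
  show ?thesis
    unfolding one_dominated_def
  proof (intro exI[of _ K] conjI bexI[of _ \<tau>])
    show "1 < K" by (simp add: K_def)
  qed (use ratio C(1,2) in auto)
qed

section \<open>Eigenbases and values of the lower spectral radius\<close>

text \<open>A positive determinant gives the two eigenvalues the same sign, so their ratio can be taken in the
  open unit interval.\<close>
lemma hyperbolic_eigenbasis:
  fixes A :: "real^2^2"
  assumes "0 < det A" "a \<noteq> b" "eigenvalue A a" "eigenvalue A b"
  obtains u s l m where "wedge u s = 1" "A *v u = l *\<^sub>R u" "A *v s = m *\<^sub>R s"
    "0 < m / l" "m / l < 1" "det A = l * m"
proof -
  note result = that
  have main: thesis if ab: "0 < b / a" "b / a < 1" "eigenvalue A a" "eigenvalue A b" for a b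
  proof -
    obtain u s where u: "u \<noteq> 0" "A *v u = a *\<^sub>R u" and s: "s \<noteq> 0" "A *v s = b *\<^sub>R s"
      using ab by (auto simp: eigenvalue_def scalar_mult_eq_scaleR)
    have ne: "a \<noteq> b" using ab by (cases "b = 0") auto
    have w: "wedge u s \<noteq> 0"
    proof
      assume 0: "wedge u s = 0"
      obtain c where c: "s = c *\<^sub>R u"
      proof (cases "u $ 1 = 0")
        case True
        then have "u $ 2 \<noteq> 0" using u by (auto simp: vec_eq_iff forall_2)
        then show ?thesis using 0 True
          by (intro that[of "s $ 2 / u $ 2"]) (auto simp: vec_eq_iff forall_2 wedge_def)
      next
        case False
        then show ?thesis using 0
          by (intro that[of "s $ 1 / u $ 1"]) (auto simp: vec_eq_iff forall_2 wedge_def field_simps)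
      qed
      have "b *\<^sub>R s = a *\<^sub>R s" unfolding s(2)[symmetric] unfolding c by (simp add: matrix_vector_mult_scaleR u)
      then show False using s ne by simp
    qed
    have "det A * wedge u s = a * b * wedge u s"
      unfolding wedge_matrix[symmetric] u s by (simp add: wedge_simps)
    then have "det A = a * b" using w by simp
    then show thesis
      using w ab u s by (intro result[of "(1 / wedge u s) *\<^sub>R u" s a b])
        (simp_all add: wedge_simps matrix_vector_mult_scaleR)
  qed
  have "det A = a * b"
  proof -
    define p where "p c = c\<^sup>2 - (A $ 1 $ 1 + A $ 2 $ 2) * c + det A" for c
    have "det (A - mat c) = p c" for c
      by (simp add: p_def det_2 mat_def power2_eq_square algebra_simps)
    then have p: "p a = 0" "p b = 0" using assms by (auto simp: eigenvalue_iff_det)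
    have "(a - b) * (a + b - (A $ 1 $ 1 + A $ 2 $ 2)) = p a - p b"
      by (simp add: p_def power2_eq_square algebra_simps)
    then have "A $ 1 $ 1 + A $ 2 $ 2 = a + b" using p assms by simp
    then show ?thesis using p(1) by (simp add: p_def power2_eq_square algebra_simps)
  qed
  then have pos: "0 < a * b" using assms by simp
  then have nz: "a \<noteq> 0" "b \<noteq> 0" by auto
  have q: "0 < b / a" "0 < a / b" using pos by (auto simp: zero_less_mult_iff zero_less_divide_iff)
  have "b / a < 1 \<or> a / b < 1"
  proof (rule ccontr)
    assume "\<not> ?thesis"
    then have "1 \<le> b / a" "1 \<le> a / b" by auto
    moreover have "a / b = inverse (b / a)" by simp
    ultimately have "b / a = 1" using one_le_inverse_iff[of "b / a"] by linarith
    then show False using assms nz by simp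
  qed
  then show thesis using main q assms by blast
qed

lemma obtain_map_preimage:
  assumes "set fs \<subseteq> f ` S"
  obtains As where "fs = map f As" "set As \<subseteq> S"
proof -
  have "fs \<in> map f ` lists S" using assms by (simp add: lists_image[symmetric] in_lists_conv_set subset_eq)
  then show ?thesis using that by auto
qed

lemma lower_spectral_radius_mat_ge:
  fixes S :: "(real^2^2) set"
  assumes S: "finite S" "S \<noteq> {}" and D: "0 \<le> D" "\<And>A. A \<in> S \<Longrightarrow> D \<le> det A"
  shows "sqrt D \<le> lower_spectral_radius_mat S"
proof (rule lower_spectral_radius_greatest)
  fix fs assume "fs \<noteq> []" "set fs \<subseteq> (*v) ` S"
  then obtain As where As: "fs = map (*v) As" "set As \<subseteq> S" by (elim obtain_map_preimage)
  have "D ^ length As \<le> (\<Prod>A\<leftarrow>As. det A)" using As(2)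
  proof (induction As)
    case (Cons A As)
    then have "D * D ^ length As \<le> det A * (\<Prod>A\<leftarrow>As. det A)"
      using D by (intro mult_mono) (auto intro: order_trans)
    then show ?case by simp
  qed simp
  also have "\<dots> \<le> (onorm ((*v) (matrix_prod As)))\<^sup>2"
    using abs_det_le_onorm_sq[of "matrix_prod As"] by (simp add: det_matrix_prod)
  finally have "(sqrt D ^ length As)\<^sup>2 \<le> (onorm ((*v) (matrix_prod As)))\<^sup>2"
    using D by (simp add: real_sqrt_power[symmetric])
  then have "sqrt D ^ length As \<le> onorm ((*v) (matrix_prod As))"
    by (rule power2_le_imp_le) (auto intro: onorm_pos_le)
  then show "sqrt D ^ length fs \<le> onorm (compose_list fs)"
    by (simp add: As compose_list_matrices)
qed (use S in auto)

lemma lower_spectral_radius_ext_square: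
  fixes S :: "(real^2^2) set"
  assumes S: "finite S" "A \<in> S" and D: "0 \<le> det A" "\<And>B. B \<in> S \<Longrightarrow> det A \<le> det B"
  shows "lower_spectral_radius (ext_square ` S) = det A"
proof (rule antisym)
  have fin: "finite (ext_square ` S)" "ext_square ` S \<noteq> {}" and
    lin: "\<And>f. f \<in> ext_square ` S \<Longrightarrow> linear f"
    using S by (auto intro: ext_square_wedge)
  have on: "onorm ((*) c) = \<bar>c\<bar>" for c :: real
    using onorm_scaleR[of "\<lambda>x. x :: real" c] by (simp add: onorm_id)
  have ext: "ext_square B = (*) (det B)" for B by (simp add: fun_eq_iff ext_square_eq_det)
  show "lower_spectral_radius (ext_square ` S) \<le> det A"
    using lower_spectral_radius_le[OF fin lin, of "[ext_square A]"] S D by (simp add: ext on)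
  show "det A \<le> lower_spectral_radius (ext_square ` S)"
  proof (rule lower_spectral_radius_greatest[OF fin lin])
    fix fs assume "fs \<noteq> []" "set fs \<subseteq> ext_square ` S"
    then obtain As where As: "fs = map ext_square As" "set As \<subseteq> S" by (elim obtain_map_preimage)
    have "det A ^ length As \<le> (\<Prod>B\<leftarrow>As. det B) \<and> compose_list (map ext_square As) = (*) (\<Prod>B\<leftarrow>As. det B)"
      using As(2)
    proof (induction As)
      case (Cons B As)
      then have "det A * det A ^ length As \<le> det B * (\<Prod>B\<leftarrow>As. det B)"
        using D by (intro mult_mono) (auto intro: order_trans)
      then show ?case using Cons by (auto simp: ext fun_eq_iff)
    qed (simp add: fun_eq_iff)
    then show "det A ^ length fs \<le> onorm (compose_list fs)"
      by (auto simp: As on intro: order_trans[OF _ abs_ge_self])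
  qed
qed

lemma matrix_prod_replicate_eigenvector:
  fixes A :: "real^'n^'n"
  shows "A *v v = c *\<^sub>R v \<Longrightarrow> matrix_prod (replicate n A) *v v = c ^ n *\<^sub>R v"
  by (induction n) (simp_all add: matrix_vector_mul_assoc[symmetric] matrix_vector_mult_scaleR mult.commute)

text \<open>If the word \<open>W\<close> maps \<open>u\<close> to a multiple of \<open>s\<close>, then \<open>A\<^sup>n W A\<^sup>n\<close> sends \<open>u\<close> to a multiple of
  \<open>(l m)\<^sup>n s\<close>, and \<open>s\<close> to a combination whose coefficients are at most of the same order because
  \<open>m\<^sup>2 \<le> l m\<close>.  The contribution of the fixed word \<open>W\<close> is negligible as \<open>n\<close> grows.\<close>
lemma lower_spectral_radius_le_of_connection:
  fixes S :: "(real^2^2) set"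
  assumes S: "finite S" "A \<in> S"
    and us: "wedge u s = 1" "A *v u = l *\<^sub>R u" "A *v s = m *\<^sub>R s" "0 < m / l" "m / l < 1"
    and W: "set W \<subseteq> S" "wedge (matrix_prod W *v u) s = 0"
  shows "lower_spectral_radius_mat S \<le> sqrt (l * m)"
proof -
  define Q where "Q = matrix_prod W"
  define c where "c = wedge u (Q *v u)"
  define e where "e = wedge (Q *v s) s"
  define f where "f = wedge u (Q *v s)"
  define D where "D = l * m"
  define K where "K = norm s * (\<bar>c\<bar> * norm s) + norm u * (\<bar>e\<bar> * norm u + \<bar>f\<bar> * norm s)"
  define r where "r = lower_spectral_radius_mat S"
  have D: "0 < D" using us(4) by (auto simp: D_def zero_less_mult_iff zero_less_divide_iff)
  have m2: "m\<^sup>2 \<le> D"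
  proof -
    have "m\<^sup>2 = (m / l) * D" using us(4) by (auto simp: D_def power2_eq_square)
    also have "\<dots> \<le> 1 * D" using us D by (intro mult_right_mono) auto
    finally show ?thesis by simp
  qed
  have "wedge (Q *v u) s = 0" using W(2) by (simp add: Q_def)
  then have Qu: "Q *v u = c *\<^sub>R s"
    by (subst wedge_basis[OF us(1), of "Q *v u"]) (simp add: c_def)
  have Qs: "Q *v s = e *\<^sub>R u + f *\<^sub>R s"
    unfolding e_def f_def by (rule wedge_basis[OF us(1)])
  define V where "V n = replicate n A @ W @ replicate n A" for n
  have bound: "onorm ((*v) (matrix_prod (V n))) \<le> K * D ^ n" for n
  proof (rule onorm_bound)
    show "0 \<le> K * D ^ n" using D by (simp add: K_def)
    fix v
    define P where "P = matrix_prod (replicate n A)"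
    have P: "P *v u = l ^ n *\<^sub>R u" "P *v s = m ^ n *\<^sub>R s"
      using us by (simp_all add: P_def matrix_prod_replicate_eigenvector)
    have V: "matrix_prod (V n) *v x = P *v (Q *v (P *v x))" for x
      by (simp add: V_def P_def Q_def matrix_prod_append matrix_vector_mul_assoc matrix_mul_assoc)
    have Vu: "matrix_prod (V n) *v u = (c * D ^ n) *\<^sub>R s"
      by (simp add: V P Qu matrix_vector_mult_scaleR D_def power_mult_distrib mult_ac)
    have Vs: "matrix_prod (V n) *v s = (e * D ^ n) *\<^sub>R u + (f * (m\<^sup>2) ^ n) *\<^sub>R s"
      by (simp add: V P Qs matrix_vector_mult_scaleR matrix_vector_right_distrib D_def
          power_mult_distrib scaleR_add_right mult_ac power2_eq_square)
    have nu: "norm (matrix_prod (V n) *v u) \<le> (\<bar>c\<bar> * norm s) * D ^ n"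
      using D by (simp add: Vu abs_mult mult_ac)
    have "norm (matrix_prod (V n) *v s) \<le> \<bar>e\<bar> * D ^ n * norm u + \<bar>f\<bar> * (m\<^sup>2) ^ n * norm s"
      unfolding Vs using D by (intro norm_triangle_le) (simp add: abs_mult power_abs)
    also have "\<dots> \<le> \<bar>e\<bar> * D ^ n * norm u + \<bar>f\<bar> * D ^ n * norm s"
      using m2 D by (intro add_mono mult_right_mono mult_left_mono power_mono) auto
    finally have ns: "norm (matrix_prod (V n) *v s) \<le> (\<bar>e\<bar> * norm u + \<bar>f\<bar> * norm s) * D ^ n"
      by (simp add: algebra_simps)
    have "matrix_prod (V n) *v v = matrix_prod (V n) *v (wedge v s *\<^sub>R u + wedge u v *\<^sub>R s)"
      by (rule arg_cong[OF wedge_basis[OF us(1)]])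
    also have "\<dots> = wedge v s *\<^sub>R (matrix_prod (V n) *v u) + wedge u v *\<^sub>R (matrix_prod (V n) *v s)"
      by (simp add: matrix_vector_right_distrib matrix_vector_mult_scaleR)
    finally have "norm (matrix_prod (V n) *v v) = norm \<dots>" by (rule arg_cong)
    also have "\<dots> \<le> \<bar>wedge v s\<bar> * norm (matrix_prod (V n) *v u) + \<bar>wedge u v\<bar> * norm (matrix_prod (V n) *v s)"
      by (intro norm_triangle_le) simp
    also have "\<dots> \<le> (norm v * norm s) * ((\<bar>c\<bar> * norm s) * D ^ n) +
        (norm u * norm v) * ((\<bar>e\<bar> * norm u + \<bar>f\<bar> * norm s) * D ^ n)"
      by (intro add_mono mult_mono nu ns abs_wedge_le) auto
    also have "\<dots> = K * D ^ n * norm v" by (simp add: K_def algebra_simps)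
    finally show "norm (matrix_prod (V n) *v v) \<le> K * D ^ n * norm v" .
  qed
  have S': "finite ((*v) ` S)" "(*v) ` S \<noteq> {}" "\<And>f. f \<in> (*v) ` S \<Longrightarrow> linear f"
    using S by auto
  have r0: "0 \<le> r" unfolding r_def by (rule lower_spectral_radius_nonneg[OF S'])
  have le: "r ^ (2 * n + length W) \<le> K * D ^ n" if "1 \<le> n" for n
  proof -
    have "r ^ length (map (*v) (V n)) \<le> onorm (compose_list (map (*v) (V n)))"
      unfolding r_def using S W that by (intro lower_spectral_radius_le S') (auto simp: V_def)
    also have "\<dots> \<le> K * D ^ n" using bound by (simp add: compose_list_matrices)
    finally have "r ^ length (map (*v) (V n)) \<le> K * D ^ n" .
    moreover have "length (map (*v) (V n)) = 2 * n + length W" by (simp add: V_def)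
    ultimately show ?thesis by (simp only:)
  qed
  show ?thesis
  proof (rule ccontr)
    assume "\<not> ?thesis"
    then have "sqrt D < r" by (simp add: r_def D_def)
    then have "(sqrt D)\<^sup>2 < r\<^sup>2" using D by (intro power_strict_mono) auto
    then have rD: "D < r\<^sup>2" using D by simp
    have rp: "0 < r" using \<open>sqrt D < r\<close> D by (meson less_trans real_sqrt_gt_zero)
    have "1 < r\<^sup>2 / D" using rD D by simp
    then obtain n where n: "K / r ^ length W < (r\<^sup>2 / D) ^ n" using real_arch_pow by blast
    have "(r\<^sup>2 / D) ^ n \<le> (r\<^sup>2 / D) ^ Suc n" using \<open>1 < r\<^sup>2 / D\<close> by (intro power_increasing) auto
    with n have "K / r ^ length W < (r\<^sup>2 / D) ^ Suc n" by linarith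
    then have "K * D ^ Suc n < (r\<^sup>2) ^ Suc n * r ^ length W"
      using rp D by (simp only: power_divide) (simp add: divide_simps mult_ac)
    then have "K * D ^ Suc n < r ^ (2 * Suc n + length W)"
      by (simp only: power_add power_mult)
    then show False using le[of "Suc n"] by simp
  qed
qed

section \<open>Failure of the lower finiteness property\<close>

text \<open>A word realising the lower spectral radius would have spectral radius \<open>\<rho>\<close> with \<open>\<rho>\<^sup>2 = (det A)\<^sup>n\<close>.  As
  \<open>\<rho>\<^sup>2\<close> dominates its determinant, the word must be a power of \<open>A\<close>, whose spectral radius is larger.\<close>
lemma not_lower_finiteness:
  fixes S :: "(real^2^2) set"
  assumes A: "A \<in> S" "0 < det A" "\<And>B. \<lbrakk>B \<in> S; B \<noteq> A\<rbrakk> \<Longrightarrow> det A < det B"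
    and ev: "a \<noteq> b" "eigenvalue A a" "eigenvalue A b"
    and lsr: "lower_spectral_radius_mat S = sqrt (det A)"
  shows "\<not> lower_finiteness_property S"
proof
  assume "lower_finiteness_property S"
  then obtain As where As: "As \<noteq> []" "set As \<subseteq> S"
    "root (length As) (spectral_radius (matrix_prod As)) = sqrt (det A)"
    unfolding lower_finiteness_property_def lsr by (metis One_nat_def list.size(3) not_one_le_zero)
  define n where "n = length As"
  define \<rho> where "\<rho> = spectral_radius (matrix_prod As)"
  have n: "0 < n" using As by (simp add: n_def)
  obtain u s l m where us: "wedge u s = 1" "A *v u = l *\<^sub>R u" "A *v s = m *\<^sub>R s"
    "0 < m / l" "m / l < 1" "det A = l * m"
    using hyperbolic_eigenbasis[OF A(2) ev] .
  have "0 \<le> \<rho>"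
  proof (rule ccontr)
    assume "\<not> 0 \<le> \<rho>"
    then have "root n \<rho> < 0" using n by simp
    then show False using As(3) A(2) by (simp add: n_def \<rho>_def)
  qed
  then have "\<rho> = sqrt (det A) ^ n" using As(3) n by (metis n_def \<rho>_def real_root_pow_pos2)
  then have \<rho>2: "\<rho>\<^sup>2 = det A ^ n"
    using A(2) by (simp add: real_sqrt_power[symmetric])
  \<comment> \<open>equality in the determinant bound characterises the powers of \<open>A\<close>\<close>
  have ge: "det A ^ length Bs \<le> (\<Prod>B\<leftarrow>Bs. det B) \<and>
      ((\<Prod>B\<leftarrow>Bs. det B) \<le> det A ^ length Bs \<longrightarrow> Bs = replicate (length Bs) A)"
    if "set Bs \<subseteq> S" for Bs
    using that
  proof (induction Bs)
    case (Cons B Bs)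
    let ?p = "\<Prod>B\<leftarrow>Bs. det B"
    have IH: "det A ^ length Bs \<le> ?p" "?p \<le> det A ^ length Bs \<longrightarrow> Bs = replicate (length Bs) A"
      using Cons by auto
    have B: "det A \<le> det B" using A Cons by (cases "B = A") (auto intro: less_imp_le)
    have pos: "0 < det A ^ length Bs" using A by simp
    have "det A * det A ^ length Bs \<le> det B * ?p" using IH(1) B A pos by (intro mult_mono) auto
    moreover have "B = A \<and> ?p \<le> det A ^ length Bs" if le: "det B * ?p \<le> det A * det A ^ length Bs"
    proof
      show "B = A"
      proof (rule ccontr)
        assume "B \<noteq> A"
        then have "det A < det B" using A Cons by auto
        then have "det A * det A ^ length Bs < det B * det A ^ length Bs" using pos by simp
        also have "\<dots> \<le> det B * ?p" using IH B A by (intro mult_left_mono) auto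
        finally show False using le by simp
      qed
      then show "?p \<le> det A ^ length Bs" using le A by simp
    qed
    ultimately show ?case using IH(2) by auto
  qed simp
  have "(\<Prod>B\<leftarrow>As. det B) \<le> det A ^ length As"
    using spectral_radius_sq_ge_det[of "matrix_prod As"] \<rho>2
    by (simp add: \<rho>_def det_matrix_prod n_def)
  then have As_eq: "As = replicate n A" using ge[OF As(2)] by (simp add: n_def)
  have "eigenvalue (matrix_prod As) (l ^ n)"
    unfolding eigenvalue_def As_eq
    using us by (intro exI[of _ u]) (auto simp: matrix_prod_replicate_eigenvector scalar_mult_eq_scaleR wedge_def)
  then have "\<bar>l ^ n\<bar> \<le> \<rho>" unfolding \<rho>_def by (rule eigenvalue_le_spectral_radius)
  then have "(l ^ n)\<^sup>2 \<le> \<rho>\<^sup>2" by (metis abs_le_square_iff abs_of_nonneg \<open>0 \<le> \<rho>\<close>)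
  then have "(l\<^sup>2) ^ n \<le> (l * m) ^ n" unfolding \<rho>2 us(6) by (simp add: power_mult[symmetric] mult.commute)
  moreover have "l * m < l\<^sup>2"
  proof -
    have l: "l \<noteq> 0" using us by auto
    have "l * m = (m / l) * l\<^sup>2" using l by (simp add: power2_eq_square)
    also have "\<dots> < 1 * l\<^sup>2" using us l by (intro mult_strict_right_mono) auto
    finally show ?thesis by simp
  qed
  then have "(l * m) ^ n < (l\<^sup>2) ^ n" using A(2) us(6) n by (intro power_strict_mono) auto
  ultimately show False by simp
qed

section \<open>The space of tuples\<close>

text \<open>Passing to the topology of pointwise convergence on all functions makes the usual continuity rules
  applicable; outside \<open>{1..k}\<close> a tuple has the constant value \<open>undefined\<close>.\<close>
lemma continuous_map_tuples_id: "continuous_map (GL2_pos_tuples k) euclidean (\<lambda>A. A)"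
proof -
  let ?X = "GL2_pos_tuples k"
  have "continuous_map ?X euclidean (\<lambda>A. A i)" for i
  proof (cases "i \<in> {1..k}")
    case True
    then have "continuous_map ?X (top_of_set GL2_pos) (\<lambda>A. A i)"
      unfolding GL2_pos_tuples_def by (rule continuous_map_product_projection)
    then show ?thesis by (rule continuous_map_into_fulltopology)
  next
    case False
    show ?thesis
    proof (rule continuous_map_eq[where f = "\<lambda>_. undefined"])
      fix A assume "A \<in> topspace ?X"
      then show "undefined = A i"
        using False unfolding GL2_pos_tuples_def by (auto simp: PiE_iff extensional_def)
    qed simp
  qed
  then show ?thesis
    unfolding euclidean_product_topology[symmetric] by (simp add: continuous_map_componentwise_UNIV)
qed

lemma openin_tuples_preimage:
  fixes f :: "(nat \<Rightarrow> real^2^2) \<Rightarrow> real"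
  assumes "continuous_on UNIV f"
  shows "openin (GL2_pos_tuples k) {A \<in> topspace (GL2_pos_tuples k). 0 < f A}"
proof -
  have "continuous_map (GL2_pos_tuples k) euclidean (f \<circ> (\<lambda>A. A))"
    by (rule continuous_map_compose[OF continuous_map_tuples_id]) (simp add: assms)
  from openin_continuous_map_preimage[OF this, of "{0<..}"] show ?thesis by simp
qed

lemma continuous_on_word_onorm:
  "continuous_on UNIV (\<lambda>A :: nat \<Rightarrow> real^'n^'n. onorm ((*v) (matrix_prod (map A w))))"
proof -
  have "continuous_on UNIV (\<lambda>A :: nat \<Rightarrow> real^'n^'n. matrix_prod (map A w))"
    by (induction w) (auto intro!: continuous_intros)
  from continuous_on_compose2[OF continuous_on_onorm_matrix this] show ?thesis by simp
qed

lemma tuple_perturbation: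
  fixes \<gamma> :: "real \<Rightarrow> nat \<Rightarrow> real^2^2"
  assumes W: "openin (GL2_pos_tuples k) W" "restrict (\<gamma> 0) {1..k} \<in> W"
    and \<gamma>: "\<And>i. i \<in> {1..k} \<Longrightarrow> continuous_on UNIV (\<lambda>t. \<gamma> t i)"
      "\<And>t i. i \<in> {1..k} \<Longrightarrow> 0 < det (\<gamma> t i)"
  obtains \<delta> where "0 < \<delta>" "\<And>t. \<bar>t\<bar> < \<delta> \<Longrightarrow> restrict (\<gamma> t) {1..k} \<in> W"
proof -
  have "continuous_map euclideanreal (GL2_pos_tuples k) (\<lambda>t. restrict (\<gamma> t) {1..k})"
    unfolding GL2_pos_tuples_def continuous_map_componentwise
  proof (intro conjI ballI)
    fix i assume "i \<in> {1..k}"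
    then show "continuous_map euclideanreal (top_of_set GL2_pos) (\<lambda>t. restrict (\<gamma> t) {1..k} i)"
      using \<gamma> by (auto simp: continuous_map_in_subtopology GL2_pos_def)
  qed auto
  from openin_continuous_map_preimage[OF this W(1)]
  have "open {t. restrict (\<gamma> t) {1..k} \<in> W}" by simp
  then obtain \<delta> where "0 < \<delta>" "ball 0 \<delta> \<subseteq> {t. restrict (\<gamma> t) {1..k} \<in> W}"
    using W(2) open_contains_ball by (metis mem_Collect_eq)
  then show ?thesis by (intro that[of \<delta>]) (auto simp: subset_eq)
qed

lemma U_setD:
  assumes "A \<in> U_set k"
  shows "A \<in> topspace (GL2_pos_tuples k)" "restrict A {1..k} = A"
    "i \<in> {1..k} \<Longrightarrow> 0 < det (A i)"
    "\<lbrakk>i \<in> {1..k}; i \<noteq> 1\<rbrakk> \<Longrightarrow> det (A 1) < det (A i)"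
    "\<exists>a b. a \<noteq> b \<and> eigenvalue (A 1) a \<and> eigenvalue (A 1) b"
    "\<not> one_dominated (A ` {1..k})"
proof -
  have *: "A \<in> {A \<in> topspace (GL2_pos_tuples k).
        (\<forall>j\<in>{2..k}. det (A 1) < det (A j)) \<and>
        (\<exists>a b. a \<noteq> b \<and> eigenvalue (A 1) a \<and> eigenvalue (A 1) b) \<and>
        \<not> one_dominated (A ` {1..k})}"
    using assms unfolding U_set_def by (rule subsetD[OF interior_of_subset])
  then show t: "A \<in> topspace (GL2_pos_tuples k)" and "\<not> one_dominated (A ` {1..k})"
    and "\<exists>a b. a \<noteq> b \<and> eigenvalue (A 1) a \<and> eigenvalue (A 1) b" by blast+
  show "det (A 1) < det (A i)" if "i \<in> {1..k}" "i \<noteq> 1"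
  proof -
    have "i \<in> {2..k}" using that by auto
    then show ?thesis using * by blast
  qed
  have PiE: "A \<in> (\<Pi>\<^sub>E i\<in>{1..k}. GL2_pos)" using t by (simp add: GL2_pos_tuples_def)
  then show "restrict A {1..k} = A" by (simp add: PiE_iff extensional_restrict)
  show "0 < det (A i)" if "i \<in> {1..k}"
    using PiE_mem[OF PiE that] by (simp add: GL2_pos_def)
qed

lemma U_set_min_det:
  assumes "1 \<le> k" "A \<in> U_set k"
  shows "0 < det (A 1)" "M \<in> A ` {1..k} \<Longrightarrow> det (A 1) \<le> det M"
proof -
  show pos: "0 < det (A 1)" using U_setD(3)[OF assms(2)] assms(1) by simp
  show "det (A 1) \<le> det M" if "M \<in> A ` {1..k}"
  proof -
    obtain i where i: "i \<in> {1..k}" "M = A i" using \<open>M \<in> A ` {1..k}\<close> by blast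
    then show ?thesis using U_setD(4)[OF assms(2) i(1)] by (cases "i = 1") auto
  qed
qed

text \<open>On \<open>\<U>\<close> the reverse inequality holds because squared operator norms dominate determinants.\<close>
lemma R_set_iff:
  assumes k: "1 \<le> k"
  shows "A \<in> R_set k \<longleftrightarrow> A \<in> U_set k \<and> lower_spectral_radius_mat (A ` {1..k}) \<le> sqrt (det (A 1))"
proof (cases "A \<in> U_set k")
  case True
  note det = U_set_min_det[OF k True]
  have "lower_spectral_radius (ext_square ` (A ` {1..k})) = det (A 1)"
    using k det by (intro lower_spectral_radius_ext_square) auto
  moreover have "sqrt (det (A 1)) \<le> lower_spectral_radius_mat (A ` {1..k})"
    using k det by (intro lower_spectral_radius_mat_ge) auto
  ultimately show ?thesis using True by (auto simp: R_set_def)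
qed (simp add: R_set_def)

lemma openin_U_set: "openin (GL2_pos_tuples k) (U_set k)"
  by (simp add: U_set_def)

text \<open>The open sets are \<open>G n\<close>, on which some word certifies that the lower spectral radius exceeds its
  minimal value by less than \<open>1 / (n + 1)\<close>.\<close>
lemma gdelta_R_set:
  assumes k: "1 \<le> k"
  shows "gdelta_in (subtopology (GL2_pos_tuples k) (U_set k)) (R_set k)"
proof -
  let ?X = "GL2_pos_tuples k"
  define N where "N A w = onorm ((*v) (matrix_prod (map A w)))" for A :: "nat \<Rightarrow> real^2^2" and w
  define H where "H n w = {A \<in> U_set k. N A w < (sqrt (det (A 1)) + 1 / real (Suc n)) ^ length w}" for n w
  define G where "G n = (\<Union>w\<in>{w. w \<noteq> [] \<and> set w \<subseteq> {1..k}}. H n w)" for n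
  have openH: "openin ?X (H n w)" for n w
  proof -
    have "continuous_on UNIV (\<lambda>A :: nat \<Rightarrow> real^2^2. (sqrt (det (A 1)) + 1 / real (Suc n)) ^ length w - N A w)"
      unfolding det_2 N_def by (intro continuous_intros continuous_on_word_onorm continuous_on_component) auto
    from openin_Int[OF openin_U_set openin_tuples_preimage[OF this]]
    show ?thesis
      by (rule back_subst[of "openin ?X"]) (auto simp: H_def dest: U_setD(1))
  qed
  have openG: "openin (subtopology ?X (U_set k)) (G n)" for n
  proof -
    have "openin ?X (G n)" unfolding G_def using openH by auto
    then show ?thesis
      by (subst openin_open_subtopology[OF openin_U_set]) (auto simp: G_def H_def)
  qed
  have R_eq: "R_set k = \<Inter> (range G)"
  proof (intro set_eqI iffI)
    fix A assume A: "A \<in> R_set k"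
    then have U: "A \<in> U_set k" "lower_spectral_radius_mat (A ` {1..k}) \<le> sqrt (det (A 1))"
      using R_set_iff[OF k] by auto
    have "A \<in> G n" for n
    proof -
      let ?S = "(*v) ` A ` {1..k}"
      have "finite ?S" "?S \<noteq> {}" "\<And>f. f \<in> ?S \<Longrightarrow> linear f" using k by auto
      from lower_spectral_radius_approx[OF this, of "1 / real (Suc n)"]
      obtain fs where fs: "fs \<noteq> []" "set fs \<subseteq> (\<lambda>i. (*v) (A i)) ` {1..k}"
        "onorm (compose_list fs) < (lower_spectral_radius_mat (A ` {1..k}) + 1 / real (Suc n)) ^ length fs"
        by (auto simp: image_image)
      obtain w where w: "fs = map (\<lambda>i. (*v) (A i)) w" "set w \<subseteq> {1..k}"
        using obtain_map_preimage[OF fs(2)] .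
      have "fs = map (*v) (map A w)" by (simp add: w o_def)
      then have "N A w = onorm (compose_list fs)" by (simp only: N_def compose_list_matrices)
      also note fs(3)
      also have "(lower_spectral_radius_mat (A ` {1..k}) + 1 / real (Suc n)) ^ length fs \<le>
          (sqrt (det (A 1)) + 1 / real (Suc n)) ^ length fs"
        using U(2) k by (intro power_mono add_mono add_nonneg_nonneg lower_spectral_radius_nonneg) auto
      finally have "A \<in> H n w" using U by (simp add: H_def w)
      then show ?thesis using w fs(1) by (auto simp: G_def)
    qed
    then show "A \<in> \<Inter> (range G)" by auto
  next
    fix A assume A: "A \<in> \<Inter> (range G)"
    then have "A \<in> G 0" by blast
    then have U: "A \<in> U_set k" by (auto simp: G_def H_def)
    have le: "lower_spectral_radius_mat (A ` {1..k}) \<le> sqrt (det (A 1)) + 1 / real (Suc n)" for n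
    proof -
      have "A \<in> G n" using A by blast
      then obtain w where w: "w \<noteq> []" "set w \<subseteq> {1..k}"
        "N A w < (sqrt (det (A 1)) + 1 / real (Suc n)) ^ length w"
        by (auto simp: G_def H_def)
      have "lower_spectral_radius_mat (A ` {1..k}) ^ length (map (*v) (map A w)) \<le> onorm (compose_list (map (*v) (map A w)))"
        using k w by (intro lower_spectral_radius_le) auto
      then have "lower_spectral_radius_mat (A ` {1..k}) ^ length w < (sqrt (det (A 1)) + 1 / real (Suc n)) ^ length w"
        using w(3) unfolding compose_list_matrices N_def by simp
      then have "lower_spectral_radius_mat (A ` {1..k}) < sqrt (det (A 1)) + 1 / real (Suc n)"
        by (rule power_less_imp_less_base) (use U_set_min_det(1)[OF k U] in auto)
      then show ?thesis by simp
    qed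
    have "(\<lambda>n. sqrt (det (A 1)) + 1 / real (Suc n)) \<longlonglongrightarrow> sqrt (det (A 1)) + 0"
      by (intro tendsto_add tendsto_const LIMSEQ_Suc[OF lim_1_over_n])
    then have "lower_spectral_radius_mat (A ` {1..k}) \<le> sqrt (det (A 1)) + 0"
      by (rule LIMSEQ_le_const) (use le in auto)
    then show "A \<in> R_set k" using R_set_iff[OF k] U by simp
  qed
  show ?thesis
    unfolding R_eq by (intro gdelta_in_Inter) (auto intro: open_imp_gdelta_in openG)
qed

text \<open>Each letter excludes at most one value of \<open>t\<close>: by invertibility it cannot send both \<open>u\<close> and \<open>s\<close> to
  multiples of \<open>s\<close>, so the wedge is a nonzero affine function of \<open>t\<close>.\<close>
lemma separate_from_eigendirection:
  fixes A :: "nat \<Rightarrow> real^2^2"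
  assumes I: "finite I" and det: "\<And>i. i \<in> I \<Longrightarrow> det (A i) \<noteq> 0" and us: "wedge u s = 1" and \<delta>: "0 < \<delta>"
  obtains t where "\<bar>t\<bar> < \<delta>" "\<And>i. i \<in> I \<Longrightarrow> wedge ((A i ** shear u t) *v s) s \<noteq> 0"
proof -
  define a where "a i = wedge (A i *v u) s" for i
  define b where "b i = wedge (A i *v s) s" for i
  have su: "wedge s u = - 1" using us by (simp add: wedge_def algebra_simps)
  have eq: "wedge ((A i ** shear u t) *v s) s = b i - t * a i" for i t
    unfolding matrix_vector_mul_assoc[symmetric] shear_mult su a_def b_def
    by (simp add: matrix_vector_right_distrib matrix_vector_mult_diff_distrib matrix_vector_mult_scaleR wedge_def algebra_simps)
  have ne: "a i \<noteq> 0 \<or> b i \<noteq> 0" if "i \<in> I" for i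
  proof (rule ccontr)
    assume "\<not> ?thesis"
    then have "A i *v u = wedge u (A i *v u) *\<^sub>R s" "A i *v s = wedge u (A i *v s) *\<^sub>R s"
      using wedge_basis[OF us, of "A i *v u"] wedge_basis[OF us, of "A i *v s"] by (metis a_def b_def add_0 scaleR_zero_left)+
    then have "wedge (A i *v u) (A i *v s) = 0" by (metis wedge_simps(3-5) mult_zero_right)
    then show False using det[OF that] us by (simp add: wedge_matrix)
  qed
  have "infinite ({0<..<\<delta>} - (\<lambda>i. b i / a i) ` I)"
    using I \<delta> by (intro Diff_infinite_finite) (auto simp: infinite_Ioo)
  then obtain t where t: "t \<in> {0<..<\<delta>} - (\<lambda>i. b i / a i) ` I"
    using infinite_imp_nonempty by blast
  show ?thesis
  proof (rule that[of t])
    show "\<bar>t\<bar> < \<delta>" using t by auto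
    fix i assume i: "i \<in> I"
    have "b i - t * a i \<noteq> 0"
    proof
      assume 0: "b i - t * a i = 0"
      then have "a i \<noteq> 0" using ne[OF i] by auto
      then have "t = b i / a i" using 0 by (simp add: field_simps)
      then show False using t i by blast
    qed
    then show "wedge ((A i ** shear u t) *v s) s \<noteq> 0" by (simp only: eq) simp
  qed
qed

text \<open>A tuple in \<open>\<U>\<close> is not 1-dominated, so some arbitrarily small perturbation of it has a connection,
  and a connection puts the perturbed tuple into \<open>\<R>\<close>.\<close>
lemma R_set_dense:
  assumes k: "1 \<le> k" and A: "A \<in> U_set k" and W: "openin (GL2_pos_tuples k) W" "A \<in> W"
  obtains B where "B \<in> R_set k" "B \<in> W"
proof -
  let ?I = "{1..k}"
  define V where "V = U_set k \<inter> W"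
  have V: "openin (GL2_pos_tuples k) V" "A \<in> V" using A W openin_U_set by (auto simp: V_def)
  have one: "1 \<in> ?I" using k by simp
  obtain u s l m where us: "wedge u s = 1" and A1: "A 1 *v u = l *\<^sub>R u" "A 1 *v s = m *\<^sub>R s"
    and lm: "0 < m / l" "m / l < 1" "det (A 1) = l * m"
    using hyperbolic_eigenbasis[OF U_set_min_det(1)[OF k A]] U_setD(5)[OF A] by metis
  \<comment> \<open>first perturbation: every letter but the first moves the direction of \<open>s\<close>\<close>
  define \<alpha> where "\<alpha> t i = (if i = 1 then A 1 else A i ** shear u t)" for t i
  have \<alpha>0: "restrict (\<alpha> 0) ?I = A"
  proof -
    have "restrict (\<alpha> 0) ?I = restrict A ?I"
      by (rule restrict_ext) (simp add: \<alpha>_def)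
    then show ?thesis using U_setD(2)[OF A] by simp
  qed
  obtain \<delta>1 where \<delta>1: "0 < \<delta>1" "\<And>t. \<bar>t\<bar> < \<delta>1 \<Longrightarrow> restrict (\<alpha> t) ?I \<in> V"
  proof (rule tuple_perturbation[OF V(1), of \<alpha>])
    show "restrict (\<alpha> 0) ?I \<in> V" using \<alpha>0 V(2) by simp
    show "continuous_on UNIV (\<lambda>t. \<alpha> t i)" for i
      by (cases "i = 1") (simp_all add: \<alpha>_def continuous_intros)
    show "0 < det (\<alpha> t i)" if "i \<in> ?I" for t i
      using U_setD(3)[OF A that] by (cases "i = 1") (simp_all add: \<alpha>_def det_mul)
  qed blast
  obtain t1 where t1: "\<bar>t1\<bar> < \<delta>1" "\<And>i. i \<in> ?I \<Longrightarrow> wedge ((A i ** shear u t1) *v s) s \<noteq> 0"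
  proof (rule separate_from_eigendirection[of ?I A u s \<delta>1])
    show "det (A i) \<noteq> 0" if "i \<in> ?I" for i using U_setD(3)[OF A that] by simp
  qed (use us \<delta>1(1) in auto)
  define A' where "A' = restrict (\<alpha> t1) ?I"
  have A'V: "A' \<in> V" using \<delta>1 t1 by (simp add: A'_def)
  then have A'U: "A' \<in> U_set k" by (simp add: V_def)
  have A'1: "A' 1 = A 1" using one by (simp add: A'_def \<alpha>_def)
  have pole: "wedge (A' i *v s) s \<noteq> 0" if "i \<in> ?I" "i \<noteq> 1" for i
    using that t1(2)[of i] by (simp add: A'_def \<alpha>_def)
  \<comment> \<open>second perturbation: the family of shears, in which a connection must occur\<close>
  define \<beta> where "\<beta> t i = shear s t ** A' i" for t i
  have \<beta>0: "restrict (\<beta> 0) ?I = A'"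
  proof -
    have "restrict (\<beta> 0) ?I = restrict A' ?I"
      by (rule restrict_ext) (simp add: \<beta>_def)
    then show ?thesis using U_setD(2)[OF A'U] by simp
  qed
  obtain \<delta>2 where \<delta>2: "0 < \<delta>2" "\<And>t. \<bar>t\<bar> < \<delta>2 \<Longrightarrow> restrict (\<beta> t) ?I \<in> V"
  proof (rule tuple_perturbation[OF V(1), of \<beta>])
    show "restrict (\<beta> 0) ?I \<in> V" using \<beta>0 A'V by simp
    show "continuous_on UNIV (\<lambda>t. \<beta> t i)" for i
      by (cases "i = 1") (simp_all add: \<beta>_def continuous_intros)
    show "0 < det (\<beta> t i)" if "i \<in> ?I" for t i
      using U_setD(3)[OF A'U that] by (cases "i = 1") (simp_all add: \<beta>_def det_mul)
  qed blast
  define v where "v t = u + (t / (1 - m / l)) *\<^sub>R s" for t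
  have "\<exists>t w. \<bar>t\<bar> \<le> 2 * (\<delta>2 / 4) \<and> w \<in> lists ?I \<and> wedge (matrix_prod (map (\<beta> t) w) *v v t) s = 0"
  proof (rule ccontr)
    assume "\<not> ?thesis"
    then have "one_dominated (A' ` ?I)"
      using us A1 lm \<delta>2(1) U_setD(3)[OF A'U] pole
      by (intro no_connection_imp_one_dominated[of ?I A' u s l m "\<delta>2 / 4"])
        (auto simp: A'1[simplified] \<beta>_def[abs_def] v_def)
    then show False using U_setD(6)[OF A'U] by simp
  qed
  then obtain t w where t: "\<bar>t\<bar> \<le> \<delta>2 / 2" and w: "w \<in> lists ?I"
    and conn: "wedge (matrix_prod (map (\<beta> t) w) *v v t) s = 0" by auto
  define B where "B = restrict (\<beta> t) ?I"
  have BV: "B \<in> V" using \<delta>2 t by (simp add: B_def)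
  have B1: "B 1 = shear s t ** A 1" using one A'1 by (simp add: B_def \<beta>_def)
  have "l \<noteq> 0" "1 - m / l \<noteq> 0" using lm by auto
  have "B 1 *v s = m *\<^sub>R s"
    unfolding B1 matrix_vector_mul_assoc[symmetric] A1 shear_mult by (simp add: wedge_simps)
  moreover have "B 1 *v v t = l *\<^sub>R v t"
  proof -
    define q where "q = t / (1 - m / l)"
    have "q * (1 - m / l) = t" using \<open>1 - m / l \<noteq> 0\<close> by (simp add: q_def)
    then have "q * (l - m) = t * l" using \<open>l \<noteq> 0\<close> by (auto simp: field_simps)
    then have q: "q * m + t * l = l * q" by (simp add: algebra_simps)
    have "A 1 *v v t = l *\<^sub>R u + (q * m) *\<^sub>R s"
      unfolding v_def q_def[symmetric] matrix_vector_right_distrib matrix_vector_mult_scaleR A1 by simp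
    then have "B 1 *v v t = l *\<^sub>R u + (q * m + t * l) *\<^sub>R s"
      unfolding B1 matrix_vector_mul_assoc[symmetric] shear_mult
      by (simp add: wedge_simps us scaleR_add_left)
    then show ?thesis unfolding q by (simp add: v_def q_def[symmetric] algebra_simps)
  qed
  moreover have "wedge (v t) s = 1" by (simp add: v_def wedge_simps us)
  moreover have "map (\<beta> t) w = map B w" using w by (auto simp: B_def)
  note conn[unfolded this]
  moreover have "set (map B w) \<subseteq> B ` ?I" unfolding set_map using w by (intro image_mono) auto
  moreover have "finite (B ` ?I)" "B 1 \<in> B ` ?I" using one by auto
  ultimately have "lower_spectral_radius_mat (B ` ?I) \<le> sqrt (l * m)"
    using lm(1,2) by (intro lower_spectral_radius_le_of_connection[of _ "B 1" "v t" s l m "map B w"])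
  moreover have "det (B 1) = l * m" unfolding B1 by (simp only: det_mul det_shear lm(3) mult_1)
  ultimately have "B \<in> R_set k"
    using BV by (simp add: R_set_iff[OF k] V_def)
  then show ?thesis using that BV by (auto simp: V_def)
qed

theorem theorem4:
  fixes k :: nat
  assumes "k \<ge> 2"
  shows "gdelta_in (subtopology (GL2_pos_tuples k) (U_set k)) (R_set k) \<and>
         (subtopology (GL2_pos_tuples k) (U_set k)) closure_of (R_set k) = U_set k \<and>
         (\<forall>A \<in> R_set k. \<not> lower_finiteness_property (A ` {1..k}))"
proof (intro conjI ballI)
  have k: "1 \<le> k" using assms by simp
  let ?Y = "subtopology (GL2_pos_tuples k) (U_set k)"
  show "gdelta_in ?Y (R_set k)" using gdelta_R_set k .
  show "?Y closure_of R_set k = U_set k"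
  proof
    show "?Y closure_of R_set k \<subseteq> U_set k" by (rule closure_of_subset_subtopology)
    show "U_set k \<subseteq> ?Y closure_of R_set k"
    proof
      fix A assume A: "A \<in> U_set k"
      have "\<exists>B. B \<in> R_set k \<and> B \<in> T" if "A \<in> T" "openin ?Y T" for T
      proof -
        have "openin (GL2_pos_tuples k) T"
          using that openin_open_subtopology[OF openin_U_set] by blast
        then show ?thesis using R_set_dense[OF k A] that by blast
      qed
      then show "A \<in> ?Y closure_of R_set k"
        using A U_setD(1)[OF A] by (simp add: in_closure_of)
    qed
  qed
  fix A assume A: "A \<in> R_set k"
  then have U: "A \<in> U_set k" by (simp add: R_set_def)
  obtain a b where ab: "a \<noteq> b" "eigenvalue (A 1) a" "eigenvalue (A 1) b"
    using U_setD(5)[OF U] by blast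
  have "lower_spectral_radius_mat (A ` {1..k}) = sqrt (det (A 1))"
  proof (rule antisym)
    show "lower_spectral_radius_mat (A ` {1..k}) \<le> sqrt (det (A 1))" using A R_set_iff[OF k] by blast
    show "sqrt (det (A 1)) \<le> lower_spectral_radius_mat (A ` {1..k})"
      using k U_set_min_det[OF k U] by (intro lower_spectral_radius_mat_ge) auto
  qed
  moreover have "det (A 1) < det B" if "B \<in> A ` {1..k}" "B \<noteq> A 1" for B
    using that U_setD(4)[OF U] by blast
  ultimately show "\<not> lower_finiteness_property (A ` {1..k})"
    using k U_set_min_det(1)[OF k U] by (intro not_lower_finiteness[OF _ _ _ ab]) auto
qed

end
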